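(* Let $B$ be a regularized finite Blaschke product with distinct critical points and $n$ distinct critical values, and suppose $B=B_n\circ B_{n-1}\circ\cdots\circ B_1$ where each $B_j$ is a regularized Blaschke product of degree $2$ with $B_j(0)=0$ for $j=1,\dots,n$. Then the monodromy group associated with $B$ is (isomorphic to) the iterated wreath product of $n$ cyclic groups of order $2$, $\mathbb{Z}_2\wr\mathbb{Z}_2\wr\cdots\wr\mathbb{Z}_2$ ($n$ factors).
   Context: A finite Blaschke product of degree $d$ is $B(z)=\gamma\prod_{j=1}^d \frac{z-a_j}{1-\overline{a_j}z}$ with $a_j\in\mathbb{D}$ and $|\gamma|=1$. It is called regularized if $B(0)=0$, all zeros of $B$ are simple, and whenever $z_1,z_2$ are critical points of $B$ in $\mathbb{D}$ with $B(z_1)/B(z_2)>0$, then $B(z_1)=B(z_2)$. Let $S$ be the set of critical points of $B$ in $\mathbb{D}$ and $B(S)$ the set of critical values. Since $0\notin B(S)$, $B^{-1}$ has $N=\deg B$ distinct local branches $g_1,\dots,g_N$ near $0$. The monodromy group of $B$ is the group of permutations of $\{g_1,\dots,g_N\}$ induced by analytic continuation along closed loops in $\mathbb{D}\setminus B(S)$ based at $0$. *)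

theory Defs
  imports "HOL-Complex_Analysis.Complex_Analysis" "HOL-Algebra.Group"
begin

definition blaschke_factors :: "nat \<Rightarrow> complex \<Rightarrow> (nat \<Rightarrow> complex) \<Rightarrow> (complex \<Rightarrow> complex) \<Rightarrow> bool" where
  "blaschke_factors d \<gamma> a B \<longleftrightarrow>
     norm \<gamma> = 1 \<and> (\<forall>j<d. a j \<in> ball 0 1) \<and>
     (\<forall>z\<in>ball 0 1. B z = \<gamma> * (\<Prod>j<d. (z - a j) / (1 - cnj (a j) * z)))"

definition blaschke :: "nat \<Rightarrow> (complex \<Rightarrow> complex) \<Rightarrow> bool" where
  "blaschke d B \<longleftrightarrow> (\<exists>\<gamma> a. blaschke_factors d \<gamma> a B)"

definition crit_points :: "(complex \<Rightarrow> complex) \<Rightarrow> complex set" where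
  "crit_points B = {z \<in> ball 0 1. deriv B z = 0}"

(* regularized: B(0) = 0, all zeros simple, and critical values lying on a common ray
   from 0 (positive ratio) coincide *)
definition regularized :: "nat \<Rightarrow> (complex \<Rightarrow> complex) \<Rightarrow> bool" where
  "regularized d B \<longleftrightarrow>
     (\<exists>\<gamma> a. blaschke_factors d \<gamma> a B \<and> inj_on a {..<d}) \<and> B 0 = 0 \<and>
     (\<forall>z1\<in>crit_points B. \<forall>z2\<in>crit_points B.
        (B z1 / B z2 \<in> \<real> \<and> Re (B z1 / B z2) > 0) \<longrightarrow> B z1 = B z2)"

fun bcomp :: "(nat \<Rightarrow> complex \<Rightarrow> complex) \<Rightarrow> nat \<Rightarrow> complex \<Rightarrow> complex" where
  "bcomp Bs 0 = id"
| "bcomp Bs (Suc k) = Bs (Suc k) \<circ> bcomp Bs k"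

definition mono_loops :: "(complex \<Rightarrow> complex) \<Rightarrow> (real \<Rightarrow> complex) set" where
  "mono_loops B = {g. path g \<and> pathstart g = 0 \<and> pathfinish g = 0 \<and>
                      path_image g \<subseteq> ball 0 1 - B ` crit_points B}"

(* F is an analytic continuation, along the path g, of a local branch of B^{-1}:
   each F t is a branch of B^{-1} (holomorphic, valued in D, right inverse of B) on a disc
   around g t, and F t agrees with F s near g t whenever t is close to s. *)
definition inv_continuation :: "(complex \<Rightarrow> complex) \<Rightarrow> (real \<Rightarrow> complex) \<Rightarrow> (real \<Rightarrow> complex \<Rightarrow> complex) \<Rightarrow> bool" where
  "inv_continuation B g F \<longleftrightarrow>
     (\<forall>t\<in>{0..1}. \<exists>r>0. F t holomorphic_on ball (g t) r \<and>
        (\<forall>w\<in>ball (g t) r. F t w \<in> ball 0 1 \<and> B (F t w) = w)) \<and>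
     (\<forall>s\<in>{0..1}. \<exists>\<delta>>0. \<forall>t\<in>{0..1}. \<bar>t - s\<bar> < \<delta> \<longrightarrow>
        (\<forall>\<^sub>F w in nhds (g t). F t w = F s w))"

(* The local branches g_1..g_N of B^{-1} near 0 are identified with their values g_i(0),
   which are the N distinct zeros of B in D.  The permutation induced by a loop: *)
definition mono_perm :: "(complex \<Rightarrow> complex) \<Rightarrow> (real \<Rightarrow> complex) \<Rightarrow> complex \<Rightarrow> complex" where
  "mono_perm B g a =
     (if a \<in> ball 0 1 \<and> B a = 0
      then (THE b. \<exists>F. inv_continuation B g F \<and> F 0 0 = a \<and> F 1 0 = b)
      else a)"

definition monodromy_group :: "(complex \<Rightarrow> complex) \<Rightarrow> (complex \<Rightarrow> complex) monoid" where
  "monodromy_group B = \<lparr>carrier = mono_perm B ` mono_loops B, mult = (\<circ>), one = id\<rparr>"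

(* Iterated wreath product Z2 wr ... wr Z2 (n factors) as a permutation group on binary words
   of length n (identity on other words): W_0 trivial, W_(k+1) = W_k wr Z2 in its imprimitive
   action, (b # ys) |-> (b xor c) # q_b ys with c in Z2 and q_0, q_1 in W_k. *)
fun wreath_Z2_carrier :: "nat \<Rightarrow> (bool list \<Rightarrow> bool list) set" where
  "wreath_Z2_carrier 0 = {id}"
| "wreath_Z2_carrier (Suc k) =
     {p. \<exists>c q0 q1. q0 \<in> wreath_Z2_carrier k \<and> q1 \<in> wreath_Z2_carrier k \<and>
          (\<forall>xs. p xs = (if length xs = Suc k
                         then (hd xs \<noteq> c) # (if hd xs then q1 (tl xs) else q0 (tl xs))
                         else xs))}"

definition wreath_Z2 :: "nat \<Rightarrow> (bool list \<Rightarrow> bool list) monoid" where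
  "wreath_Z2 n = \<lparr>carrier = wreath_Z2_carrier n, mult = (\<circ>), one = id\<rparr>"

end

theory Submission
  imports Defs
begin

text \<open>
  A regularized Blaschke product of degree 2 is \<open>\<phi> \<circ> (z \<mapsto> z\<^sup>2) \<circ> \<psi>\<close> with disc automorphisms
  \<open>\<phi>\<close> and \<open>\<psi>\<close>, so the zeros of \<open>B\<close> are the leaves of a complete binary tree of depth \<open>n\<close>,
  whose nodes at depth \<open>m\<close> are the zeros of the composition \<open>U m\<close> of the \<open>m\<close> outermost factors.
  Lifting a loop through the factors one after the other shows that monodromy acts by tree
  automorphisms. Conversely, the \<open>n\<close> critical values are distinct, so over a small disc around one
  of them exactly one sheet of \<open>U m\<close> meets the branch point of the next factor. A lasso around this
  critical value, approached along the image of a path that starts at a node \<open>y\<close> of depth \<open>m\<close> and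
  ends on that sheet, exchanges the two children of \<open>y\<close> and fixes all other nodes of depth \<open>m + 1\<close>.
  Such sibling swaps suffice to realize every tree automorphism level by level.
\<close>

section \<open>Branched double covers of the disc\<close>

text \<open>What a sibling swap does below depth \<open>m + 1\<close> is not controlled, and this
  shapes the argument: \<open>sibling_swap_loop\<close> describes the action through
  \<open>U (Suc m)\<close> only, and an automorphism is matched from the root downwards. A
  correction at depth \<open>m + 1\<close> keeps every parent, so it never disturbs the levels
  already matched; whatever it does further down is repaired later.

  That the values \<open>u j\<close> are distinct is used in two ways. The disc around
  \<open>u m\<close> contains no \<open>u j\<close> with \<open>j < m\<close>, so \<open>U m\<close>
  has holomorphic sections there, and two sections that meet are equal, so only one takes the value
  \<open>v m\<close>. It contains no \<open>u j\<close> with \<open>j > m\<close> either, so the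
  lasso is admissible for the full product. That 0 is not a critical value makes 0 a legitimate base
  point and gives every node two different children.

  The path from \<open>y\<close> to the branched sheet needs no prior transitivity: the preimage of
  the critical values is finite, and the disc minus a finite set is path connected.

  Both groups are brought to the common form \<open>tree_auts\<close>, so an isomorphism only asks
  for a bijection of the leaves that respects ancestors.\<close>

abbreviation (input) disc :: "complex set" where "disc \<equiv> ball 0 1"

definition disc_auto :: "(complex \<Rightarrow> complex) \<Rightarrow> (complex \<Rightarrow> complex) \<Rightarrow> bool" where
  "disc_auto f g \<longleftrightarrow> f holomorphic_on disc \<and> g holomorphic_on disc \<and> f ` disc \<subseteq> disc \<and> g ` disc \<subseteq> disc \<and>
     (\<forall>z\<in>disc. g (f z) = z \<and> f (g z) = z)"

text \<open>Here \<open>c\<close> is the critical point, \<open>v\<close> the critical value, and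
  \<open>\<sigma>\<close> the deck involution: negation carried over by \<open>\<psi>\<close>,
  exchanging the two points of each fibre.\<close>

definition fold_map :: "(complex \<Rightarrow> complex) \<Rightarrow> complex \<Rightarrow> (complex \<Rightarrow> complex) \<Rightarrow> complex \<Rightarrow> bool" where
  "fold_map f c \<sigma> v \<longleftrightarrow> (\<exists>\<phi> \<phi>' \<psi> \<psi>'. disc_auto \<phi> \<phi>' \<and> disc_auto \<psi> \<psi>' \<and>
     (\<forall>z\<in>disc. f z = \<phi> ((\<psi> z)\<^sup>2)) \<and> c = \<psi>' 0 \<and> v = \<phi> 0 \<and> \<sigma> = (\<lambda>z. \<psi>' (- \<psi> z)))"

lemma disc_autoD:
  assumes "disc_auto f g"
  shows "f holomorphic_on disc" "g holomorphic_on disc"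
    "\<And>z. z \<in> disc \<Longrightarrow> f z \<in> disc" "\<And>z. z \<in> disc \<Longrightarrow> g z \<in> disc"
    "\<And>z. z \<in> disc \<Longrightarrow> g (f z) = z" "\<And>z. z \<in> disc \<Longrightarrow> f (g z) = z"
  using assms unfolding disc_auto_def by blast+

lemma disc_auto_eq_iff:
  assumes "disc_auto f g" "x \<in> disc" "y \<in> disc"
  shows "f x = f y \<longleftrightarrow> x = y"
  by (metis assms disc_autoD(5))

lemma disc_auto_deriv_nonzero:
  assumes "disc_auto f g" "z \<in> disc"
  shows "deriv f z \<noteq> 0"
proof -
  have "inj_on f disc" using disc_auto_eq_iff[OF assms(1)] by (auto simp: inj_on_def)
  then show ?thesis
    using assms holomorphic_injective_imp_regular[OF disc_autoD(1)[OF assms(1)]] by blast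
qed

lemma power2_disc: "z \<in> disc \<Longrightarrow> z\<^sup>2 \<in> disc"
  by (simp add: norm_power power_less_one_iff)

lemma fold_map_basic:
  assumes "fold_map f c \<sigma> v"
  shows fold_map_holomorphic: "f holomorphic_on disc"
    and fold_map_in_disc: "\<And>z. z \<in> disc \<Longrightarrow> f z \<in> disc"
    and fold_map_surj: "\<And>w. w \<in> disc \<Longrightarrow> \<exists>z\<in>disc. f z = w"
    and fold_map_crit_disc: "c \<in> disc"
    and fold_map_crit_value: "f c = v"
    and fold_map_flip_disc: "\<And>z. z \<in> disc \<Longrightarrow> \<sigma> z \<in> disc"
    and fold_map_flip_holomorphic: "\<sigma> holomorphic_on disc"
    and fold_map_fibre: "\<And>x y. x \<in> disc \<Longrightarrow> y \<in> disc \<Longrightarrow> f x = f y \<longleftrightarrow> y = x \<or> y = \<sigma> x"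
    and fold_map_flip_neq: "\<And>x. x \<in> disc \<Longrightarrow> f x \<noteq> v \<Longrightarrow> \<sigma> x \<noteq> x"
    and fold_map_deriv: "\<And>z. z \<in> disc \<Longrightarrow> deriv f z = 0 \<longleftrightarrow> z = c"
proof -
  obtain \<phi> \<phi>' \<psi> \<psi>' where \<phi>: "disc_auto \<phi> \<phi>'" and \<psi>: "disc_auto \<psi> \<psi>'"
    and f: "\<And>z. z \<in> disc \<Longrightarrow> f z = \<phi> ((\<psi> z)\<^sup>2)" and c: "c = \<psi>' 0" and v: "v = \<phi> 0"
    and \<sigma>: "\<sigma> = (\<lambda>z. \<psi>' (- \<psi> z))"
    using assms unfolding fold_map_def by blast
  note \<phi>D = disc_autoD[OF \<phi>] and \<psi>D = disc_autoD[OF \<psi>]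
  have sq: "(\<psi> z)\<^sup>2 \<in> disc" if "z \<in> disc" for z
    using \<psi>D(3)[OF that] by (rule power2_disc)
  have "(\<lambda>z. \<phi> ((\<psi> z)\<^sup>2)) holomorphic_on disc"
  proof (rule holomorphic_on_compose_gen[of "\<lambda>z. (\<psi> z)\<^sup>2" disc \<phi> disc, unfolded o_def])
    show "(\<lambda>z. (\<psi> z)\<^sup>2) holomorphic_on disc" using \<psi>D(1) by (intro holomorphic_intros)
  qed (use \<phi>D(1) sq in auto)
  then show "f holomorphic_on disc"
    by (rule holomorphic_transform) (use f in simp)
  show "f z \<in> disc" if "z \<in> disc" for z
    using f[OF that] \<phi>D(3)[OF sq[OF that]] by simp
  have neg: "- \<psi> z \<in> disc" if "z \<in> disc" for z
    using \<psi>D(3)[OF that] by auto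
  show "\<exists>z\<in>disc. f z = w" if w: "w \<in> disc" for w
  proof -
    define q where "q = csqrt (\<phi>' w)"
    have q2: "q\<^sup>2 = \<phi>' w" by (simp add: q_def)
    have "norm (q\<^sup>2) < 1" using \<phi>D(4)[OF w] q2 by simp
    then have q: "q \<in> disc"
      by (simp add: norm_power power_less_one_iff)
    have "f (\<psi>' q) = w" using f \<psi>D(4)[OF q] \<psi>D(6)[OF q] q2 \<phi>D(6)[OF w] by simp
    then show ?thesis using \<psi>D(4)[OF q] by blast
  qed
  have 0: "(0::complex) \<in> disc" by simp
  show cd: "c \<in> disc" using c \<psi>D(4)[OF 0] by simp
  show "f c = v" using f[OF cd] c v \<psi>D(6)[OF 0] by simp
  show "\<sigma> z \<in> disc" if "z \<in> disc" for z
    using \<psi>D(4)[OF neg[OF that]] \<sigma> by simp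
  show "\<sigma> holomorphic_on disc"
    unfolding \<sigma>
  proof (rule holomorphic_on_compose_gen[of "\<lambda>z. - \<psi> z" disc \<psi>' disc, unfolded o_def])
    show "(\<lambda>z. - \<psi> z) holomorphic_on disc" using \<psi>D(1) by (intro holomorphic_intros)
  qed (use \<psi>D(2) neg in auto)
  show "f x = f y \<longleftrightarrow> y = x \<or> y = \<sigma> x" if x: "x \<in> disc" and y: "y \<in> disc" for x y
  proof -
    have "f x = f y \<longleftrightarrow> (\<psi> y)\<^sup>2 = (\<psi> x)\<^sup>2"
      using f x y sq disc_auto_eq_iff[OF \<phi>] by (auto simp del: mem_ball)
    also have "\<dots> \<longleftrightarrow> \<psi> y = \<psi> x \<or> \<psi> y = - \<psi> x" by (simp add: power2_eq_iff)
    also have "\<psi> y = \<psi> x \<longleftrightarrow> y = x" using disc_auto_eq_iff[OF \<psi>] x y by blast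
    also have "\<psi> y = - \<psi> x \<longleftrightarrow> y = \<sigma> x"
      using \<sigma> \<psi>D(5)[OF y] \<psi>D(6)[OF neg[OF x]] by metis
    finally show ?thesis .
  qed
  show "\<sigma> x \<noteq> x" if x: "x \<in> disc" and "f x \<noteq> v" for x
  proof
    assume "\<sigma> x = x"
    then have "- \<psi> x = \<psi> x" using \<sigma> \<psi>D(6)[OF neg[OF x]] by metis
    then have "\<psi> x = 0" by simp
    then show False using f[OF x] v that(2) by simp
  qed
  show "deriv f z = 0 \<longleftrightarrow> z = c" if z: "z \<in> disc" for z
  proof -
    have d\<psi>: "(\<psi> has_field_derivative deriv \<psi> z) (at z)"
      using \<psi>D(1) z by (simp add: holomorphic_derivI)
    have d\<phi>: "(\<phi> has_field_derivative deriv \<phi> ((\<psi> z)\<^sup>2)) (at ((\<psi> z)\<^sup>2))"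
      using \<phi>D(1) sq[OF z] by (meson holomorphic_derivI open_ball)
    have "((\<lambda>z. (\<psi> z)\<^sup>2) has_field_derivative 2 * \<psi> z * deriv \<psi> z) (at z)"
      using DERIV_power[OF d\<psi>, of 2] by (simp add: mult_ac)
    then have "((\<lambda>z. \<phi> ((\<psi> z)\<^sup>2)) has_field_derivative deriv \<phi> ((\<psi> z)\<^sup>2) * (2 * \<psi> z * deriv \<psi> z)) (at z)"
      using DERIV_chain2[where f = \<phi> and g = "\<lambda>z. (\<psi> z)\<^sup>2" and x = z] d\<phi> by blast
    then have "(f has_field_derivative deriv \<phi> ((\<psi> z)\<^sup>2) * (2 * \<psi> z * deriv \<psi> z)) (at z)"
      by (rule has_field_derivative_transform_within_open[of _ _ _ disc]) (use z f in auto)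
    then have "deriv f z = deriv \<phi> ((\<psi> z)\<^sup>2) * (2 * \<psi> z * deriv \<psi> z)"
      by (rule DERIV_imp_deriv)
    then have "deriv f z = 0 \<longleftrightarrow> \<psi> z = 0"
      using disc_auto_deriv_nonzero[OF \<phi> sq[OF z]] disc_auto_deriv_nonzero[OF \<psi> z] by simp
    also have "\<dots> \<longleftrightarrow> z = c"
      using c \<psi>D(5)[OF z] \<psi>D(6)[OF 0] by metis
    finally show ?thesis .
  qed
qed

text \<open>Up to automorphisms, lifting \<open>s\<close> through \<open>f\<close> means extracting
  a holomorphic square root of \<open>\<phi>' \<circ> s\<close>. One exists because a ball is
  contractible and \<open>\<phi>' \<circ> s\<close> vanishes only where \<open>s\<close> takes the
  value \<open>v\<close>.\<close>

lemma fold_map_lift_section: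
  assumes F: "fold_map f c \<sigma> v" and s: "s holomorphic_on ball u r" "s ` ball u r \<subseteq> disc"
    and v: "v \<notin> s ` ball u r" and b: "b \<in> ball u r" and x: "x \<in> disc" "f x = s b"
  obtains s' where "s' holomorphic_on ball u r" "s' ` ball u r \<subseteq> disc"
    "\<And>w. w \<in> ball u r \<Longrightarrow> f (s' w) = s w" "s' b = x"
proof -
  obtain \<phi> \<phi>' \<psi> \<psi>' where \<phi>: "disc_auto \<phi> \<phi>'" and \<psi>: "disc_auto \<psi> \<psi>'"
    and f: "\<And>z. z \<in> disc \<Longrightarrow> f z = \<phi> ((\<psi> z)\<^sup>2)" and v': "v = \<phi> 0"
    using F unfolding fold_map_def by blast
  note \<phi>D = disc_autoD[OF \<phi>] and \<psi>D = disc_autoD[OF \<psi>]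
  have sd: "s w \<in> disc" if "w \<in> ball u r" for w using s(2) that by blast
  have hol: "(\<lambda>w. \<phi>' (s w)) holomorphic_on ball u r"
    using holomorphic_on_compose_gen[OF s(1) \<phi>D(2) s(2)] by (simp add: o_def)
  have nz: "\<phi>' (s w) \<noteq> 0" if "w \<in> ball u r" for w
    using v v' \<phi>D(6)[OF sd[OF that]] that by force
  obtain k0 where k0: "k0 holomorphic_on ball u r" "\<And>w. w \<in> ball u r \<Longrightarrow> \<phi>' (s w) = (k0 w)\<^sup>2"
    using contractible_imp_holomorphic_sqrt[OF hol convex_imp_contractible[OF convex_ball]] nz by metis
  have "(\<psi> x)\<^sup>2 = (k0 b)\<^sup>2"
    using k0(2)[OF b] x f[OF x(1)] \<phi>D(5)[OF power2_disc[OF \<psi>D(3)[OF x(1)]]] by simp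
  \<comment> \<open>The two roots differ by a sign; \<open>e\<close> selects the one whose lift
    passes through the prescribed point \<open>x\<close>.\<close>
  then obtain e where e: "\<psi> x = e * k0 b" "e\<^sup>2 = 1"
    by (metis mult_1 mult_minus1 power2_eq_iff one_power2 power2_minus)
  define k where "k w = e * k0 w" for w
  have k: "k holomorphic_on ball u r" "\<And>w. w \<in> ball u r \<Longrightarrow> \<phi>' (s w) = (k w)\<^sup>2" "k b = \<psi> x"
    using k0 e unfolding k_def by (auto intro!: holomorphic_intros simp: power_mult_distrib)
  have kd: "k w \<in> disc" if "w \<in> ball u r" for w
  proof -
    have "norm ((k w)\<^sup>2) < 1" using \<phi>D(4)[OF sd[OF that]] k(2)[OF that] by simp
    then show ?thesis by (simp add: norm_power power_less_one_iff)
  qed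
  show ?thesis
  proof
    have "k ` ball u r \<subseteq> disc" using kd by blast
    then show "(\<lambda>w. \<psi>' (k w)) holomorphic_on ball u r"
      using holomorphic_on_compose_gen[OF k(1) \<psi>D(2)] by (simp add: o_def)
    show "(\<lambda>w. \<psi>' (k w)) ` ball u r \<subseteq> disc" using kd \<psi>D(4) by blast
    show "f (\<psi>' (k w)) = s w" if "w \<in> ball u r" for w
      using f[OF \<psi>D(4)[OF kd[OF that]]] \<psi>D(6)[OF kd[OF that]] k(2)[OF that] \<phi>D(6)[OF sd[OF that]]
      by simp
    show "\<psi>' (k b) = x" using k(3) \<psi>D(5)[OF x(1)] by simp
  qed
qed

text \<open>A simple loop around the branch point lifts to a path that moves to the other sheet, because the
  square root of \<open>w - u\<close> changes sign along it.\<close>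

lemma fold_map_lift_circle:
  assumes F: "fold_map f c \<sigma> v" and s: "s holomorphic_on ball u r" "s ` ball u r \<subseteq> disc" "inj_on s (ball u r)"
    and v: "s u = v" and \<rho>: "0 < \<rho>" "\<rho> < r" and x: "x \<in> disc" "f x = s (u + of_real \<rho>)"
  obtains h where "path h" "path_image h \<subseteq> disc" "pathstart h = x" "pathfinish h = \<sigma> x"
    "\<And>t. t \<in> {0..1} \<Longrightarrow> f (h t) = s (circlepath u \<rho> t)"
proof -
  obtain \<phi> \<phi>' \<psi> \<psi>' where \<phi>: "disc_auto \<phi> \<phi>'" and \<psi>: "disc_auto \<psi> \<psi>'"
    and f: "\<And>z. z \<in> disc \<Longrightarrow> f z = \<phi> ((\<psi> z)\<^sup>2)" and v': "v = \<phi> 0" and \<sigma>: "\<sigma> = (\<lambda>z. \<psi>' (- \<psi> z))"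
    using F unfolding fold_map_def by blast
  note \<phi>D = disc_autoD[OF \<phi>] and \<psi>D = disc_autoD[OF \<psi>]
  have sd: "s w \<in> disc" if "w \<in> ball u r" for w using s(2) that by blast
  define G where "G w = \<phi>' (s w)" for w
  have hol: "G holomorphic_on ball u r"
    using holomorphic_on_compose_gen[OF s(1) \<phi>D(2) s(2)] by (simp add: o_def G_def[abs_def])
  have u: "u \<in> ball u r" using \<rho> by simp
  have Gu: "G u = 0" using v v' \<phi>D(5)[of 0] by (simp add: G_def)
  have inj: "inj_on G (ball u r)"
    unfolding inj_on_def G_def by (metis \<phi>D(6) inj_onD s(3) sd)
  \<comment> \<open>\<open>G\<close> is injective with \<open>G u = 0\<close>, so its zero at
    \<open>u\<close> is simple. Dividing it out leaves a nonvanishing holomorphic \<open>k\<close>,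
    which has a square root \<open>l\<close> on the whole ball.\<close>
  define k where "k w = (if w = u then deriv G u else (G w - G u) / (w - u))" for w
  have kh: "k holomorphic_on ball u r"
    unfolding k_def by (rule pole_lemma_open[OF hol open_ball])
  have kG: "G w = (w - u) * k w" for w
    using Gu by (simp add: k_def)
  have knz: "k w \<noteq> 0" if "w \<in> ball u r" for w
  proof (cases "w = u")
    case True
    then show ?thesis
      using holomorphic_injective_imp_regular[OF hol open_ball inj u] by (simp add: k_def)
  next
    case False
    then have "G w \<noteq> 0" using inj Gu u that by (metis inj_onD)
    then show ?thesis using kG by auto
  qed
  obtain l where l: "l holomorphic_on ball u r" "\<And>w. w \<in> ball u r \<Longrightarrow> k w = (l w)\<^sup>2"
    using contractible_imp_holomorphic_sqrt[OF kh convex_imp_contractible[OF convex_ball]] knz by metis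
  \<comment> \<open>A continuous square root of \<open>G\<close> along the circle. Its exponential
    runs at half speed and so makes half a turn, while the factor \<open>l\<close> returns to its
    initial value; hence \<open>m 1 = - m 0\<close>.\<close>
  define m where "m t = of_real (sqrt \<rho>) * exp (of_real pi * \<i> * of_real t) * l (circlepath u \<rho> t)" for t :: real
  have circ: "circlepath u \<rho> t \<in> ball u r" for t
    using \<rho> by (simp add: circlepath dist_norm norm_mult)
  have msq: "(m t)\<^sup>2 = G (circlepath u \<rho> t)" for t
  proof -
    have "(m t)\<^sup>2 = of_real ((sqrt \<rho>)\<^sup>2) * (exp (of_real pi * \<i> * of_real t))\<^sup>2 * (l (circlepath u \<rho> t))\<^sup>2"
      unfolding m_def power_mult_distrib of_real_power by simp
    also have "(exp (of_real pi * \<i> * of_real t))\<^sup>2 = exp (2 * of_real pi * \<i> * of_real t)"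
      by (simp add: exp_double[symmetric] mult_ac)
    also have "of_real ((sqrt \<rho>)\<^sup>2) = (of_real \<rho> :: complex)" using \<rho> by simp
    finally show ?thesis
      using l(2)[OF circ[of t], symmetric] kG[of "circlepath u \<rho> t"] by (simp add: circlepath)
  qed
  have m1: "m 1 = - m 0"
    by (simp add: m_def circlepath)
  have mcont: "continuous_on {0..1} m"
    unfolding m_def
    by (intro continuous_intros continuous_on_compose2[OF holomorphic_on_imp_continuous_on[OF l(1)]])
       (use circ path_circlepath[of u \<rho>] in \<open>auto simp: path_def\<close>)
  have "(\<psi> x)\<^sup>2 = (m 0)\<^sup>2"
    using msq[of 0] x f[OF x(1)] \<phi>D(5)[OF power2_disc[OF \<psi>D(3)[OF x(1)]]] by (simp add: circlepath G_def)
  then obtain e where e: "\<psi> x = e * m 0" "e\<^sup>2 = 1"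
    by (metis mult_1 mult_minus1 power2_eq_iff one_power2 power2_minus)
  have em: "e * m t \<in> disc" for t
  proof -
    have "norm ((e * m t)\<^sup>2) < 1"
      using \<phi>D(4)[OF sd[OF circ[of t]]] msq[of t] e by (simp add: power_mult_distrib G_def)
    then show ?thesis by (simp add: norm_power power_less_one_iff)
  qed
  have h: "continuous_on {0..1} (\<lambda>t. \<psi>' (e * m t))"
    by (rule continuous_on_compose2[OF holomorphic_on_imp_continuous_on[OF \<psi>D(2)]])
       (use em mcont in \<open>auto intro!: continuous_intros\<close>)
  show ?thesis
  proof
    show "path (\<lambda>t. \<psi>' (e * m t))" using h by (simp add: path_def)
    show "path_image (\<lambda>t. \<psi>' (e * m t)) \<subseteq> disc" using \<psi>D(4)[OF em] by (auto simp: path_image_def)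
    show "pathstart (\<lambda>t. \<psi>' (e * m t)) = x"
      using e \<psi>D(5)[OF x(1)] by (simp add: pathstart_def)
    show "pathfinish (\<lambda>t. \<psi>' (e * m t)) = \<sigma> x"
      using e m1 \<sigma> by (simp add: pathfinish_def)
    show "f (\<psi>' (e * m t)) = s (circlepath u \<rho> t)" if "t \<in> {0..1}" for t
      using f[OF \<psi>D(4)[OF em[of t]]] \<psi>D(6)[OF em[of t]] msq[of t] e \<phi>D(6)[OF sd[OF circ[of t]]]
      by (simp add: power_mult_distrib G_def)
  qed
qed

section \<open>Blaschke products of degree 2\<close>

lemma disc_auto_Moebius:
  assumes "norm c < 1"
  shows "disc_auto (Moebius_function 0 c) (Moebius_function 0 (- c))"
  unfolding disc_auto_def
  using assms Moebius_function_holomorphic[of c 0] Moebius_function_holomorphic[of "-c" 0]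
    Moebius_function_norm_lt_1[of c _ 0] Moebius_function_norm_lt_1[of "-c" _ 0]
    Moebius_function_compose[of c "-c"] Moebius_function_compose[of "-c" c]
  by (auto simp: image_subset_iff)

lemma disc_auto_rotate:
  assumes "disc_auto f g" "norm \<gamma> = 1"
  shows "disc_auto (\<lambda>z. \<gamma> * f z) (\<lambda>z. g (z / \<gamma>))"
proof -
  have nz: "\<gamma> \<noteq> 0" using assms(2) by auto
  note D = disc_autoD[OF assms(1)]
  have quot: "z / \<gamma> \<in> disc" if "z \<in> disc" for z using that assms(2) by (simp add: norm_divide)
  have "(\<lambda>z. g (z / \<gamma>)) holomorphic_on disc"
  proof (rule holomorphic_on_compose_gen[of "\<lambda>z. z / \<gamma>" disc g disc, unfolded o_def])
    show "(\<lambda>z. z / \<gamma>) holomorphic_on disc" using nz by (intro holomorphic_intros) auto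
  qed (use D(2) quot in auto)
  moreover have "\<gamma> * f z \<in> disc" if "z \<in> disc" for z
    using D(3)[OF that] assms(2) by (simp add: norm_mult)
  moreover have "(\<lambda>z. \<gamma> * f z) holomorphic_on disc" using D(1) by (intro holomorphic_intros)
  moreover have "g (z / \<gamma>) \<in> disc" if "z \<in> disc" for z using D(4)[OF quot[OF that]] .
  moreover have "\<gamma> * f (g (z / \<gamma>)) = z" if "z \<in> disc" for z using D(6)[OF quot[OF that]] nz by simp
  ultimately show ?thesis unfolding disc_auto_def using nz D(5) by auto
qed

text \<open>The critical point of \<open>z (z - a) / (1 - cnj a z)\<close> is the fixed point \<open>c\<close> of the
  disc involution exchanging \<open>0\<close> and \<open>a\<close>.\<close>

lemma blaschke_midpoint:
  fixes a :: complex
  assumes "norm a < 1"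
  obtains c where "norm c < 1" "a * (1 + c * cnj c) = 2 * c"
proof -
  \<comment> \<open>With \<open>c = a / k\<close> the required equation becomes
    \<open>k\<^sup>2 + (norm a)\<^sup>2 = 2 * k\<close>. The larger root exceeds 1, which puts
    \<open>c\<close> in the disc.\<close>
  define k where "k = 1 + sqrt (1 - (norm a)\<^sup>2)"
  have n: "(norm a)\<^sup>2 < 1" using assms by (simp add: power_less_one_iff)
  have k: "k > 1" using n by (simp add: k_def)
  have k2: "k\<^sup>2 + (norm a)\<^sup>2 = 2 * k"
    using n by (simp add: k_def power2_eq_square algebra_simps)
  have kc: "complex_of_real k \<noteq> 0" using k by simp
  show ?thesis
  proof
    show "norm (a / of_real k) < 1" using k assms by (simp add: norm_divide)
    have "a * (1 + (a / of_real k) * cnj (a / of_real k)) = a * (of_real (k\<^sup>2 + (norm a)\<^sup>2) / of_real (k\<^sup>2))"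
      unfolding of_real_add of_real_power complex_norm_square[of a, unfolded of_real_power]
      using kc by (simp add: field_simps power2_eq_square)
    also have "\<dots> = 2 * (a / of_real k)" unfolding k2 using kc by (simp add: power2_eq_square)
    finally show "a * (1 + (a / of_real k) * cnj (a / of_real k)) = 2 * (a / of_real k)" .
  qed
qed

lemma one_minus_cnj_mult_nonzero:
  assumes "norm a < 1" "norm z < 1"
  shows "1 - cnj a * z \<noteq> 0"
proof -
  have "norm (cnj a * z) < 1" using norm_mult_less[of "cnj a" 1 z 1] assms by simp
  then show ?thesis by auto
qed

text \<open>The inner Moebius map moves the critical point \<open>c\<close> to 0. It sends 0 to
  \<open>-c\<close>, and the left side vanishes at 0, so the outer map must send
  \<open>c\<^sup>2\<close> to 0; this explains its parameter. The rest is algebra: after clearing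
  denominators, a common factor \<open>1 - cnj c * c\<close> cancels.\<close>

lemma blaschke_quadratic_identity:
  assumes a: "norm a < 1" and c: "norm c < 1" and ac: "a * (1 + c * cnj c) = 2 * c" and z: "norm z < 1"
  shows "z * ((z - a) / (1 - cnj a * z)) = Moebius_function 0 (c\<^sup>2) ((Moebius_function 0 c z)\<^sup>2)"
proof -
  define k where "k = 1 + c * cnj c"
  have knz: "k \<noteq> 0"
  proof
    assume "k = 0"
    then have "c = 0" using ac by (simp add: k_def)
    then show False using \<open>k = 0\<close> by (simp add: k_def)
  qed
  have a': "a = 2 * c / k" using ac knz by (simp add: k_def field_simps)
  have cnjk: "cnj k = k" by (simp add: k_def mult.commute)
  have ca': "cnj a = 2 * cnj c / k" using a' cnjk by simp
  define p q where "p = z - c" and "q = 1 - cnj c * z"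
  have q: "q \<noteq> 0" using one_minus_cnj_mult_nonzero[OF c z] by (simp add: q_def)
  have az: "1 - cnj a * z \<noteq> 0" using one_minus_cnj_mult_nonzero[OF a z] .
  have lhs: "(z - a) / (1 - cnj a * z) = (k * z - 2 * c) / (k - 2 * cnj c * z)"
  proof -
    have "z - a = (k * z - 2 * c) / k" "1 - cnj a * z = (k - 2 * cnj c * z) / k"
      using knz unfolding ca' by (simp_all add: a' field_simps)
    then show ?thesis using knz by simp
  qed
  have den: "k - 2 * cnj c * z \<noteq> 0"
    using az knz unfolding ca' by (auto simp: field_simps)
  have cc: "1 - cnj c * c \<noteq> 0" using one_minus_cnj_mult_nonzero[OF c c] .
  have n1: "p\<^sup>2 - c\<^sup>2 * q\<^sup>2 = (1 - cnj c * c) * (z * (k * z - 2 * c))"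
    unfolding p_def q_def k_def by (simp add: algebra_simps power2_eq_square)
  have n2: "q\<^sup>2 - cnj (c\<^sup>2) * p\<^sup>2 = (1 - cnj c * c) * (k - 2 * cnj c * z)"
    unfolding p_def q_def k_def by (simp add: algebra_simps power2_eq_square)
  have "Moebius_function 0 (c\<^sup>2) ((Moebius_function 0 c z)\<^sup>2) = ((p / q)\<^sup>2 - c\<^sup>2) / (1 - cnj (c\<^sup>2) * (p / q)\<^sup>2)"
    by (simp add: Moebius_function_simple p_def q_def)
  also have "\<dots> = (p\<^sup>2 - c\<^sup>2 * q\<^sup>2) / (q\<^sup>2 - cnj (c\<^sup>2) * p\<^sup>2)"
  proof -
    have "(p / q)\<^sup>2 - c\<^sup>2 = (p\<^sup>2 - c\<^sup>2 * q\<^sup>2) / q\<^sup>2" "1 - cnj (c\<^sup>2) * (p / q)\<^sup>2 = (q\<^sup>2 - cnj (c\<^sup>2) * p\<^sup>2) / q\<^sup>2"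
      using q by (simp_all add: field_simps)
    then show ?thesis using q by simp
  qed
  also have "\<dots> = z * (k * z - 2 * c) / (k - 2 * cnj c * z)"
    unfolding n1 n2 using cc by simp
  finally show ?thesis using lhs by simp
qed

lemma regularized_2_fold_map:
  assumes "regularized 2 f"
  obtains c \<sigma> v where "fold_map f c \<sigma> v"
proof -
  obtain \<gamma> and a :: "nat \<Rightarrow> complex" where \<gamma>: "norm \<gamma> = 1" and a: "\<forall>j<2. a j \<in> disc"
    and f: "\<And>z. z \<in> disc \<Longrightarrow> f z = \<gamma> * (\<Prod>j<2. (z - a j) / (1 - cnj (a j) * z))"
    using assms unfolding regularized_def blaschke_factors_def by blast
  have f0: "f 0 = 0" using assms unfolding regularized_def by blast
  have "a 0 = 0 \<or> a (Suc 0) = 0"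
    using f[of 0] f0 \<gamma> by (auto simp: numeral_2_eq_2)
  then obtain b where b: "norm b < 1" "\<And>z. z \<in> disc \<Longrightarrow> f z = \<gamma> * (z * ((z - b) / (1 - cnj b * z)))"
  proof
    assume "a 0 = 0"
    with that[of "a (Suc 0)"] a f show thesis by (simp add: numeral_2_eq_2)
  next
    assume "a (Suc 0) = 0"
    with that[of "a 0"] a f show thesis by (simp add: numeral_2_eq_2 mult.commute)
  qed
  obtain c where c: "norm c < 1" "b * (1 + c * cnj c) = 2 * c"
    using blaschke_midpoint[OF b(1)] by blast
  have c2: "norm (c\<^sup>2) < 1" using c by (simp add: norm_power power_less_one_iff)
  let ?\<phi> = "\<lambda>z. \<gamma> * Moebius_function 0 (c\<^sup>2) z"
  have 1: "disc_auto ?\<phi> (\<lambda>z. Moebius_function 0 (- c\<^sup>2) (z / \<gamma>))"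
    using disc_auto_rotate[OF disc_auto_Moebius[OF c2] \<gamma>] .
  have 2: "f z = ?\<phi> ((Moebius_function 0 c z)\<^sup>2)" if "z \<in> disc" for z
    unfolding b(2)[OF that] using blaschke_quadratic_identity[OF b(1) c, of z] that by simp
  have "fold_map f (Moebius_function 0 (- c) 0)
      (\<lambda>z. Moebius_function 0 (- c) (- Moebius_function 0 c z)) (?\<phi> 0)"
    unfolding fold_map_def using 1 2 disc_auto_Moebius[OF c(1)]
    by (intro exI[of _ ?\<phi>] exI[of _ "\<lambda>z. Moebius_function 0 (- c\<^sup>2) (z / \<gamma>)"]
        exI[of _ "Moebius_function 0 c"] exI[of _ "Moebius_function 0 (- c)"]) blast
  then show ?thesis by (rule that)
qed

text \<open>Dividing out the factor \<open>w - z\<close> leaves a function \<open>k\<close> with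
  \<open>deriv B z = k z\<close>, and \<open>k z\<close> is nonzero because the remaining zeros
  differ from \<open>z\<close>. This keeps 0 out of the critical values.\<close>

lemma blaschke_simple_zero_deriv:
  assumes B: "blaschke_factors d \<gamma> a B" and inj: "inj_on a {..<d}" and z: "z \<in> disc" "B z = 0"
  shows "deriv B z \<noteq> 0"
proof -
  have a: "norm (a j) < 1" if "j < d" for j using B that unfolding blaschke_factors_def by auto
  have \<gamma>: "\<gamma> \<noteq> 0" using B unfolding blaschke_factors_def by auto
  have BB: "B w = \<gamma> * (\<Prod>j<d. (w - a j) / (1 - cnj (a j) * w))" if "w \<in> disc" for w
    using B that unfolding blaschke_factors_def by auto
  obtain i where i: "i < d" "z = a i"
    using BB[OF z(1)] z \<gamma> a one_minus_cnj_mult_nonzero by force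
  define k where "k w = \<gamma> * (\<Prod>j\<in>{..<d}-{i}. (w - a j) / (1 - cnj (a j) * w)) / (1 - cnj (a i) * w)" for w
  have Bk: "B w = (w - z) * k w" if "w \<in> disc" for w
    unfolding BB[OF that] k_def using i by (subst prod.remove[of _ i]) auto
  have nz: "1 - cnj (a j) * w \<noteq> 0" if "j < d" "w \<in> disc" for j w
    using one_minus_cnj_mult_nonzero a that by simp
  have "k holomorphic_on disc"
    unfolding k_def using nz i by (intro holomorphic_intros) auto
  then have "((\<lambda>w. (w - z) * k w) has_field_derivative 1 * k z + deriv k z * (z - z)) (at z)"
    using z(1) by (intro DERIV_mult holomorphic_derivI[of _ disc] derivative_eq_intros) auto
  then have "((\<lambda>w. (w - z) * k w) has_field_derivative k z) (at z)" by simp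
  then have "(B has_field_derivative k z) (at z)"
    by (rule has_field_derivative_transform_within_open[of _ _ _ disc]) (use z Bk in auto)
  then have "deriv B z = k z" by (rule DERIV_imp_deriv)
  moreover have "z \<noteq> a j" if "j \<in> {..<d} - {i}" for j
    using inj i that by (auto simp: inj_on_def)
  then have "k z \<noteq> 0" unfolding k_def using \<gamma> nz z i by auto
  ultimately show ?thesis by simp
qed

section \<open>Sections and covering maps\<close>

text \<open>Differentiating \<open>f (s w) = w\<close> shows that \<open>deriv f\<close> cannot
  vanish on the image of a section.\<close>

lemma section_local_inj:
  assumes f: "f holomorphic_on S" "open S" and s: "s holomorphic_on T" "open T" "s ` T \<subseteq> S"
    and fs: "\<And>w. w \<in> T \<Longrightarrow> f (s w) = w" and w: "w \<in> T"
  obtains r where "r > 0" "ball (s w) r \<subseteq> S" "inj_on f (ball (s w) r)"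
proof -
  have sw: "s w \<in> S" using s(3) w by blast
  have "((\<lambda>z. f (s z)) has_field_derivative deriv f (s w) * deriv s w) (at w)"
    using DERIV_chain2[where f = f and g = s and x = w] holomorphic_derivI[OF f sw] holomorphic_derivI[OF s(1,2) w]
    by blast
  then have "((\<lambda>z. z) has_field_derivative deriv f (s w) * deriv s w) (at w)"
    by (rule has_field_derivative_transform_within_open[of _ _ _ T]) (use s(2) w fs in auto)
  then have "deriv f (s w) * deriv s w = 1"
    using DERIV_ident DERIV_unique by blast
  then have "deriv f (s w) \<noteq> 0" by auto
  then show ?thesis
    using has_complex_derivative_locally_injective[OF f(1) sw f(2)] that by blast
qed

text \<open>The set where two sections agree is closed by continuity and open by local injectivity
  of \<open>f\<close>, so it is all of the connected set \<open>T\<close> once it is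
  nonempty.\<close>

lemma section_unique:
  assumes f: "f holomorphic_on S" "open S" and T: "open T" "connected T"
    and s: "s holomorphic_on T" "s ` T \<subseteq> S" "\<And>w. w \<in> T \<Longrightarrow> f (s w) = w"
    and t: "t holomorphic_on T" "t ` T \<subseteq> S" "\<And>w. w \<in> T \<Longrightarrow> f (t w) = w"
    and a: "a \<in> T" "s a = t a" and w: "w \<in> T"
  shows "s w = t w"
proof -
  have cs: "continuous_on T s" and ct: "continuous_on T t"
    using s t holomorphic_on_imp_continuous_on by blast+
  let ?E = "{w \<in> T. s w = t w}"
  have "closedin (top_of_set T) ?E"
  proof -
    have "?E = {w \<in> T. s w - t w = 0}" by auto
    then show ?thesis
      using continuous_closedin_preimage_constant[of T "\<lambda>w. s w - t w" 0] cs ct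
      by (simp add: continuous_on_diff)
  qed
  moreover have "open ?E"
  proof (subst open_contains_ball, intro ballI)
    fix z assume "z \<in> ?E"
    then have z: "z \<in> T" "s z = t z" by auto
    obtain r where r: "r > 0" "inj_on f (ball (s z) r)"
      using section_local_inj[OF f s(1) T(1) s(2,3) z(1)] by blast
    have "open (T \<inter> s -` ball (s z) r)" "open (T \<inter> t -` ball (s z) r)"
      using cs ct T(1) continuous_open_preimage open_ball by blast+
    then have "open ((T \<inter> s -` ball (s z) r) \<inter> (T \<inter> t -` ball (s z) r))" by blast
    moreover have "z \<in> (T \<inter> s -` ball (s z) r) \<inter> (T \<inter> t -` ball (s z) r)" using z r by auto
    moreover have "(T \<inter> s -` ball (s z) r) \<inter> (T \<inter> t -` ball (s z) r) \<subseteq> ?E"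
    proof
      fix y assume y: "y \<in> (T \<inter> s -` ball (s z) r) \<inter> (T \<inter> t -` ball (s z) r)"
      then have "f (s y) = f (t y)" using s(3) t(3) by simp
      then show "y \<in> ?E" using y r(2) by (auto dest: inj_onD simp del: mem_ball)
    qed
    ultimately show "\<exists>e>0. ball z e \<subseteq> ?E" by (meson open_contains_ball subset_trans)
  qed
  then have "openin (top_of_set T) ?E" by (intro open_subset) auto
  ultimately have "?E = {} \<or> ?E = T" using T(2) connected_clopen by blast
  then show ?thesis using a w by auto
qed

text \<open>The radius in \<open>sec\<close> serves all points over the ball at once, so the ball is
  evenly covered: the sheets are the images of all sections. They are open because an injective
  holomorphic map is open. Two sheets that meet do so over a single point of the ball, hence their
  sections coincide.\<close>

lemma covering_space_of_sections:
  assumes f: "f holomorphic_on C" "open C" "f ` C = S"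
    and sec: "\<And>w. w \<in> S \<Longrightarrow> \<exists>r>0. ball w r \<subseteq> S \<and> (\<forall>x\<in>C. f x \<in> ball w r \<longrightarrow>
       (\<exists>s. s holomorphic_on ball w r \<and> s ` ball w r \<subseteq> C \<and> (\<forall>z\<in>ball w r. f (s z) = z) \<and> s (f x) = x))"
  shows "covering_space C f S"
  unfolding covering_space_def
proof (intro conjI ballI)
  show "continuous_on C f" using f holomorphic_on_imp_continuous_on by blast
  show "f ` C = S" by fact
  fix w assume w: "w \<in> S"
  obtain r where r: "r > 0" "ball w r \<subseteq> S" and ex: "\<And>x. x \<in> C \<Longrightarrow> f x \<in> ball w r \<Longrightarrow>
       \<exists>s. s holomorphic_on ball w r \<and> s ` ball w r \<subseteq> C \<and> (\<forall>z\<in>ball w r. f (s z) = z) \<and> s (f x) = x"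
    using sec[OF w] by blast
  let ?T = "ball w r"
  define sect where "sect s \<longleftrightarrow> s holomorphic_on ?T \<and> s ` ?T \<subseteq> C \<and> (\<forall>z\<in>?T. f (s z) = z)" for s
  let ?v = "(\<lambda>s. s ` ?T) ` Collect sect"
  show "\<exists>T. w \<in> T \<and> openin (top_of_set S) T \<and> (\<exists>v. \<Union>v = C \<inter> f -` T \<and>
      (\<forall>u\<in>v. openin (top_of_set C) u) \<and> pairwise disjnt v \<and> (\<forall>u\<in>v. \<exists>q. homeomorphism u T f q))"
  proof (intro exI[of _ ?T] conjI exI[of _ ?v] ballI)
    show "w \<in> ?T" using r by simp
    show "openin (top_of_set S) ?T" using r by (simp add: open_subset)
    show "\<Union>?v = C \<inter> f -` ?T"
    proof
      show "\<Union>?v \<subseteq> C \<inter> f -` ?T" unfolding sect_def by auto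
      show "C \<inter> f -` ?T \<subseteq> \<Union>?v"
      proof
        fix x assume x: "x \<in> C \<inter> f -` ?T"
        then obtain s where "sect s" "s (f x) = x" using ex[of x] unfolding sect_def by auto
        then have "s \<in> Collect sect" "x \<in> s ` ?T" using x by (auto intro: rev_image_eqI)
        then show "x \<in> \<Union>?v" by blast
      qed
    qed
    show "openin (top_of_set C) u" if u: "u \<in> ?v" for u
    proof -
      obtain s where s: "sect s" "u = s ` ?T" using u by blast
      have "inj_on s ?T" using s(1) unfolding sect_def by (metis inj_onI)
      then have "open (s ` ?T)"
        using open_mapping_thm3[of s ?T] s(1) unfolding sect_def by blast
      then show ?thesis using s unfolding sect_def by (simp add: open_subset)
    qed
    show "pairwise disjnt ?v"
    proof (rule pairwiseI)
      fix u u' assume u: "u \<in> ?v" "u' \<in> ?v" "u \<noteq> u'"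
      then obtain s t where s: "sect s" "u = s ` ?T" and t: "sect t" "u' = t ` ?T" by blast
      show "disjnt u u'"
      proof (rule ccontr)
        assume "\<not> disjnt u u'"
        then obtain a b where ab: "a \<in> ?T" "b \<in> ?T" "s a = t b"
          using s t unfolding disjnt_def by blast
        then have "a = b" using s(1) t(1) unfolding sect_def by metis
        then have eq: "s a = t a" using ab(3) by simp
        have sD: "s holomorphic_on ?T" "s ` ?T \<subseteq> C" "\<And>z. z \<in> ?T \<Longrightarrow> f (s z) = z"
          and tD: "t holomorphic_on ?T" "t ` ?T \<subseteq> C" "\<And>z. z \<in> ?T \<Longrightarrow> f (t z) = z"
          using s(1) t(1) unfolding sect_def by auto
        have "s z = t z" if "z \<in> ?T" for z
          using section_unique[OF f(1,2) open_ball connected_ball sD tD ab(1) eq that] .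
        then have "s ` ?T = t ` ?T" by (rule image_cong[OF refl])
        then show False using u(3) s(2) t(2) by simp
      qed
    qed
    show "\<exists>q. homeomorphism u ?T f q" if u: "u \<in> ?v" for u
    proof -
      obtain s where s: "sect s" "u = s ` ?T" using u by blast
      have "continuous_on ?T s" "continuous_on u f"
        using s f(1) unfolding sect_def by (meson holomorphic_on_imp_continuous_on holomorphic_on_subset)+
      then have hh: "homeomorphism u ?T f s"
        unfolding homeomorphism_def using s(1) unfolding s(2) sect_def by (force simp: image_image)
      then show ?thesis by blast
    qed
  qed
qed

section \<open>Towers of double covers and their critical values\<close>

primrec tower_map :: "(nat \<Rightarrow> complex \<Rightarrow> complex) \<Rightarrow> nat \<Rightarrow> complex \<Rightarrow> complex" where
  "tower_map f 0 = (\<lambda>z. z)"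
| "tower_map f (Suc m) = (\<lambda>z. tower_map f m (f m z))"

locale fold_chain =
  fixes f \<sigma> :: "nat \<Rightarrow> complex \<Rightarrow> complex" and c v :: "nat \<Rightarrow> complex" and n :: nat
  assumes fold: "m < n \<Longrightarrow> fold_map (f m) (c m) (\<sigma> m) (v m)"
begin

abbreviation "U \<equiv> tower_map f"

text \<open>The critical value that the factor \<open>f m\<close> contributes to the tower: its own
  critical value \<open>v m\<close>, carried to the bottom by the factors outside it.\<close>

definition u :: "nat \<Rightarrow> complex" where "u m = U m (v m)"

lemma tower_map_basic:
  assumes "m \<le> n"
  shows U_holomorphic: "U m holomorphic_on disc"
    and U_in_disc: "\<And>z. z \<in> disc \<Longrightarrow> U m z \<in> disc"
    and U_surj: "\<And>w. w \<in> disc \<Longrightarrow> \<exists>z\<in>disc. U m z = w"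
proof -
  have "U m holomorphic_on disc \<and> U m ` disc = disc"
    using assms
  proof (induction m)
    case 0
    then show ?case by (simp add: id_def)
  next
    case (Suc m)
    have F: "fold_map (f m) (c m) (\<sigma> m) (v m)" using fold Suc.prems by simp
    have im: "f m ` disc = disc"
      using fold_map_in_disc[OF F] fold_map_surj[OF F] by (auto simp del: mem_ball) blast
    have "U m \<circ> f m holomorphic_on disc"
      using holomorphic_on_compose_gen[OF fold_map_holomorphic[OF F], of "U m" disc] Suc im by simp
    moreover have "(\<lambda>z. U m (f m z)) ` disc = disc"
      using im Suc by (metis Suc_leD image_image)
    ultimately show ?case by (simp add: o_def)
  qed
  then have U: "U m holomorphic_on disc" "U m ` disc = disc" by simp_all
  show "U m holomorphic_on disc" by (rule U(1))
  show "U m z \<in> disc" if "z \<in> disc" for z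
    using imageI[OF that, of "U m"] U(2) by simp
  show "\<exists>z\<in>disc. U m z = w" if "w \<in> disc" for w
  proof -
    have "w \<in> U m ` disc" using that U(2) by simp
    then show ?thesis by (rule imageE) auto
  qed
qed

text \<open>By the chain rule the critical points of \<open>U (Suc m)\<close> are \<open>c m\<close>
  and the preimages under \<open>f m\<close> of those of \<open>U m\<close>. Since
  \<open>f m\<close> is onto the disc, the latter contribute exactly the old critical
  values.\<close>

lemma U_critical_values:
  assumes "m \<le> n"
  shows "U m ` crit_points (U m) = u ` {..<m}"
  using assms
proof (induction m)
  case 0
  have "deriv (\<lambda>x. x) z = (1::complex)" for z by (rule DERIV_imp_deriv) (rule DERIV_ident)
  then show ?case by (simp add: crit_points_def id_def)
next
  case (Suc m)
  have F: "fold_map (f m) (c m) (\<sigma> m) (v m)" using fold Suc.prems by simp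
  have m: "m \<le> n" using Suc.prems by simp
  have d: "deriv (U (Suc m)) z = 0 \<longleftrightarrow> deriv (U m) (f m z) = 0 \<or> z = c m" if z: "z \<in> disc" for z
  proof -
    have "deriv (U (Suc m)) z = deriv (U m) (f m z) * deriv (f m) z"
      using deriv_chain[of "f m" z "U m", unfolded o_def] fold_map_holomorphic[OF F] U_holomorphic[OF m]
        fold_map_in_disc[OF F z] z
      by (simp add: holomorphic_on_imp_differentiable_at del: mem_ball)
    then show ?thesis using fold_map_deriv[OF F z] by simp
  qed
  have fc: "f m (c m) = v m" "c m \<in> disc"
    using fold_map_crit_value[OF F] fold_map_crit_disc[OF F] by auto
  have "crit_points (U (Suc m)) = {z \<in> disc. f m z \<in> crit_points (U m)} \<union> {c m}"
    using d fc fold_map_in_disc[OF F] unfolding crit_points_def by blast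
  then have "U (Suc m) ` crit_points (U (Suc m)) = U m ` f m ` ({z \<in> disc. f m z \<in> crit_points (U m)} \<union> {c m})"
    by (simp add: image_image)
  moreover have "f m ` {z \<in> disc. f m z \<in> crit_points (U m)} = crit_points (U m)"
  proof
    show "crit_points (U m) \<subseteq> f m ` {z \<in> disc. f m z \<in> crit_points (U m)}"
    proof
      fix y assume y: "y \<in> crit_points (U m)"
      then have "y \<in> disc" by (simp add: crit_points_def)
      then obtain z where "z \<in> disc" "f m z = y" using fold_map_surj[OF F] by blast
      then show "y \<in> f m ` {z \<in> disc. f m z \<in> crit_points (U m)}" using y by blast
    qed
  qed blast
  ultimately have "U (Suc m) ` crit_points (U (Suc m)) = U m ` crit_points (U m) \<union> {U m (f m (c m))}"
    by (simp only: image_Un) simp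
  then show ?case using Suc.IH[OF m] fc by (simp add: lessThan_Suc u_def)
qed

text \<open>The section is lifted through one fold at a time. A section \<open>s\<close> of
  \<open>U m\<close> cannot take the value \<open>v m\<close>, for then
  \<open>u m = U m (v m)\<close> would lie in the ball.\<close>

lemma U_section:
  assumes "m \<le> n" "ball w r \<subseteq> disc" "ball w r \<inter> u ` {..<m} = {}" "x \<in> disc" "U m x \<in> ball w r"
  shows "\<exists>s. s holomorphic_on ball w r \<and> s ` ball w r \<subseteq> disc \<and> (\<forall>z\<in>ball w r. U m (s z) = z) \<and> s (U m x) = x"
  using assms
proof (induction m arbitrary: x)
  case 0
  then show ?case by (intro exI[of _ "\<lambda>z. z"]) auto
next
  case (Suc m)
  have F: "fold_map (f m) (c m) (\<sigma> m) (v m)" using fold Suc.prems by simp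
  have "ball w r \<inter> u ` {..<m} = {}" using Suc.prems(3) by (auto simp: lessThan_Suc)
  then obtain s where s: "s holomorphic_on ball w r" "s ` ball w r \<subseteq> disc"
      "\<And>z. z \<in> ball w r \<Longrightarrow> U m (s z) = z" "s (U m (f m x)) = f m x"
    using Suc.IH[of "f m x"] Suc.prems fold_map_in_disc[OF F] by auto
  have vm: "v m \<notin> s ` ball w r"
  proof
    assume "v m \<in> s ` ball w r"
    then obtain z where z: "v m = s z" "z \<in> ball w r" by (rule imageE)
    then have "u m \<in> ball w r" using s(3)[OF z(2)] by (simp add: u_def)
    then show False using Suc.prems(3) by auto
  qed
  have fx: "U m (f m x) \<in> ball w r" "f m x = s (U m (f m x))" using Suc.prems(5) s(4) by auto
  obtain s' where "s' holomorphic_on ball w r" "s' ` ball w r \<subseteq> disc"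
     "\<And>z. z \<in> ball w r \<Longrightarrow> f m (s' z) = s z" "s' (U m (f m x)) = x"
    using fold_map_lift_section[OF F s(1,2) vm fx(1) Suc.prems(4) fx(2)] by blast
  then show ?case using s by (intro exI[of _ s']) auto
qed

lemma open_disc_minus_values: "open (disc - u ` {..<m})"
  by (intro open_Diff finite_imp_closed) auto

lemma covering_U:
  assumes m: "m \<le> n"
  shows "covering_space (disc - U m -` u ` {..<m}) (U m) (disc - u ` {..<m})" (is "covering_space ?C _ ?S")
proof (rule covering_space_of_sections)
  have C: "?C = disc \<inter> U m -` ?S" using U_in_disc[OF m] by auto
  show "U m holomorphic_on ?C" using U_holomorphic[OF m] by (rule holomorphic_on_subset) auto
  show "open ?C" unfolding C
    using U_holomorphic[OF m] open_disc_minus_values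
    by (intro continuous_open_preimage holomorphic_on_imp_continuous_on) auto
  show "U m ` ?C = ?S"
  proof
    show "U m ` ?C \<subseteq> ?S" using U_in_disc[OF m] by (simp add: image_subset_iff)
    show "?S \<subseteq> U m ` ?C"
    proof
      fix y assume y: "y \<in> ?S"
      then obtain z where "z \<in> disc" "U m z = y" using U_surj[OF m] by blast
      then show "y \<in> U m ` ?C" using y by (intro image_eqI[of _ _ z]) auto
    qed
  qed
  fix w assume w: "w \<in> ?S"
  then obtain r where r: "r > 0" "ball w r \<subseteq> ?S" using open_disc_minus_values open_contains_ball by blast
  show "\<exists>r>0. ball w r \<subseteq> ?S \<and> (\<forall>x\<in>?C. U m x \<in> ball w r \<longrightarrow>
       (\<exists>s. s holomorphic_on ball w r \<and> s ` ball w r \<subseteq> ?C \<and> (\<forall>z\<in>ball w r. U m (s z) = z) \<and> s (U m x) = x))"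
  proof (intro exI[of _ r] conjI ballI impI)
    fix x assume x: "x \<in> ?C" "U m x \<in> ball w r"
    have b: "ball w r \<subseteq> disc" "ball w r \<inter> u ` {..<m} = {}" using r(2) by blast+
    obtain s where s: "s holomorphic_on ball w r" "s ` ball w r \<subseteq> disc"
       "\<And>z. z \<in> ball w r \<Longrightarrow> U m (s z) = z" "s (U m x) = x"
      using U_section[OF m b DiffD1[OF x(1)] x(2)] by blast
    moreover have "s ` ball w r \<subseteq> ?C" using s(2,3) r(2) by (auto simp: image_subset_iff simp del: mem_ball)
    ultimately show "\<exists>s. s holomorphic_on ball w r \<and> s ` ball w r \<subseteq> ?C \<and> (\<forall>z\<in>ball w r. U m (s z) = z) \<and> s (U m x) = x"
      by blast
  qed (fact r)+
qed

end

section \<open>Lifts of paths\<close>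

definition is_lift :: "(complex \<Rightarrow> complex) \<Rightarrow> (real \<Rightarrow> complex) \<Rightarrow> (real \<Rightarrow> complex) \<Rightarrow> bool" where
  "is_lift F g h \<longleftrightarrow> path h \<and> path_image h \<subseteq> disc \<and> (\<forall>t\<in>{0..1}. F (h t) = g t)"

text \<open>A relation and not a function: joining and reversing hold for all paths, whereas
  existence and uniqueness of the end point are proved for paths that avoid the critical
  values.\<close>

definition lifts_to :: "(complex \<Rightarrow> complex) \<Rightarrow> (real \<Rightarrow> complex) \<Rightarrow> complex \<Rightarrow> complex \<Rightarrow> bool" where
  "lifts_to F g x y \<longleftrightarrow> (\<exists>h. is_lift F g h \<and> pathstart h = x \<and> pathfinish h = y)"

lemma is_lift_mem: "is_lift F g h \<Longrightarrow> t \<in> {0..1} \<Longrightarrow> h t \<in> disc"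
  unfolding is_lift_def path_image_def by blast

lemma is_lift_ends:
  assumes "is_lift F g h"
  shows "pathstart h \<in> disc" "pathfinish h \<in> disc" "F (pathstart h) = pathstart g" "F (pathfinish h) = pathfinish g"
  using assms is_lift_mem[OF assms, of 0] is_lift_mem[OF assms, of 1]
  by (auto simp: is_lift_def pathstart_def pathfinish_def)

lemma is_lift_join:
  assumes "is_lift F g1 h1" "is_lift F g2 h2" "pathfinish h1 = pathstart h2"
  shows "is_lift F (g1 +++ g2) (h1 +++ h2)"
  unfolding is_lift_def
proof (intro conjI ballI)
  show "path (h1 +++ h2)" using assms by (simp add: is_lift_def)
  show "path_image (h1 +++ h2) \<subseteq> disc"
    using assms by (intro subset_path_image_join) (auto simp: is_lift_def)
  show "F ((h1 +++ h2) t) = (g1 +++ g2) t" if "t \<in> {0..1}" for t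
    using that assms(1,2) by (auto simp: is_lift_def joinpaths_def)
qed

lemma is_lift_reverse:
  assumes "is_lift F g h"
  shows "is_lift F (reversepath g) (reversepath h)"
  using assms by (auto simp: is_lift_def reversepath_def[of g] path_image_reversepath) (simp add: reversepath_def)

lemma lifts_to_join:
  assumes "lifts_to F g1 x y" "lifts_to F g2 y z"
  shows "lifts_to F (g1 +++ g2) x z"
  using assms is_lift_join unfolding lifts_to_def by (metis pathfinish_join pathstart_join)

lemma lifts_to_reverse:
  assumes "lifts_to F g x y"
  shows "lifts_to F (reversepath g) y x"
  using assms is_lift_reverse unfolding lifts_to_def by (metis pathfinish_reversepath pathstart_reversepath)

text \<open>Used in two ways: with \<open>s = f m\<close> it pushes a lift one level towards the
  root, and with \<open>s = \<sigma> m\<close> it yields the conjugate lift of the same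
  path.\<close>

lemma is_lift_compose_left:
  assumes h: "is_lift F g h" and s: "s holomorphic_on disc" "\<And>z. z \<in> disc \<Longrightarrow> s z \<in> disc"
    and G: "\<And>z. z \<in> disc \<Longrightarrow> G (s z) = F z"
  shows "is_lift G g (s \<circ> h)"
  unfolding is_lift_def
proof (intro conjI ballI)
  have "path_image h \<subseteq> disc" "path h" using h by (auto simp: is_lift_def)
  then show "path (s \<circ> h)"
    using s(1) by (intro path_continuous_image) (auto intro: holomorphic_on_imp_continuous_on holomorphic_on_subset)
  show "path_image (s \<circ> h) \<subseteq> disc"
    using is_lift_mem[OF h] s(2) by (auto simp: path_image_def simp del: mem_ball)
  show "G ((s \<circ> h) t) = g t" if "t \<in> {0..1}" for t
    using G is_lift_mem[OF h that] h that by (simp add: is_lift_def del: mem_ball)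
qed

section \<open>Path lifting when the critical values are distinct and nonzero\<close>

locale fold_tower = fold_chain +
  assumes inj_values: "inj_on u {..<n}" and zero_value: "0 \<notin> u ` {..<n}"
begin

abbreviation base :: "complex set" where "base \<equiv> disc - u ` {..<n}"

lemma lift_exists:
  assumes m: "m \<le> n" and g: "path g" "path_image g \<subseteq> base" and x: "x \<in> disc" "U m x = pathstart g"
  obtains h where "is_lift (U m) g h" "pathstart h = x"
proof -
  have sub: "path_image g \<subseteq> disc - u ` {..<m}" using g(2) m by auto
  moreover have "pathstart g \<in> path_image g" by (rule pathstart_in_path_image)
  ultimately have "x \<in> disc - U m -` u ` {..<m}" using x by auto
  then obtain h where "path h" "path_image h \<subseteq> disc - U m -` u ` {..<m}" "pathstart h = x"
      "\<And>t. t \<in> {0..1} \<Longrightarrow> U m (h t) = g t"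
    using covering_space_lift_path_strong[OF covering_U[OF m] _ g(1) sub x(2)[symmetric]] by blast
  then show ?thesis using that[of h] by (auto simp: is_lift_def)
qed

text \<open>The common point may occur at any time \<open>a\<close>; taking \<open>a = 1\<close>
  compares two lifts backwards from their end points.\<close>

lemma lift_unique:
  assumes m: "m \<le> n" and g: "path g" "path_image g \<subseteq> base" and h: "is_lift (U m) g h" and k: "is_lift (U m) g k"
    and a: "a \<in> {0..1}" "h a = k a" and t: "t \<in> {0..1}"
  shows "h t = k t"
proof (rule covering_space_lift_unique[OF covering_U[OF m], where ?g1.0 = h and ?g2.0 = k and a = a and f = g and T = "{0..1}"])
  have gt: "g t \<in> disc - u ` {..<m}" if "t \<in> {0..1}" for t
  proof -
    have "g t \<in> base" using g(2) that unfolding path_image_def by blast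
    then show ?thesis using m by auto
  qed
  show "h a = k a" by fact
  show "continuous_on {0..1} g" using g(1) by (simp add: path_def)
  show "g \<in> {0..1} \<rightarrow> disc - u ` {..<m}" using gt by blast
  show "continuous_on {0..1} h" "continuous_on {0..1} k" using h k by (auto simp: is_lift_def path_def)
  show "h \<in> {0..1} \<rightarrow> disc - U m -` u ` {..<m}" "k \<in> {0..1} \<rightarrow> disc - U m -` u ` {..<m}"
    using gt is_lift_mem[OF h] is_lift_mem[OF k] h k by (auto simp: is_lift_def simp del: mem_ball)
  show "g x = U m (h x)" "g x = U m (k x)" if "x \<in> {0..1}" for x
    using h k that by (auto simp: is_lift_def)
qed (use a t in auto)

lemma lifts_to_unique:
  assumes "m \<le> n" "path g" "path_image g \<subseteq> base" "lifts_to (U m) g x y" "lifts_to (U m) g x y'"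
  shows "y = y'"
proof -
  obtain h k where h: "is_lift (U m) g h" "h 0 = x" "h 1 = y" and k: "is_lift (U m) g k" "k 0 = x" "k 1 = y'"
    using assms(4,5) unfolding lifts_to_def pathstart_def pathfinish_def by blast
  show ?thesis using lift_unique[OF assms(1-3) h(1) k(1), of 0 1] h k by simp
qed

lemma lifts_to_exists:
  assumes "m \<le> n" "path g" "path_image g \<subseteq> base" "x \<in> disc" "U m x = pathstart g"
  obtains y where "y \<in> disc" "U m y = pathfinish g" "lifts_to (U m) g x y"
  using lift_exists[OF assms] is_lift_ends unfolding lifts_to_def by metis

lemma is_lift_Suc:
  assumes "m < n" "is_lift (U (Suc m)) g h"
  shows "is_lift (U m) g (f m \<circ> h)"
  using is_lift_compose_left[OF assms(2) fold_map_holomorphic[OF fold[OF assms(1)]]]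
    fold_map_in_disc[OF fold[OF assms(1)]] by simp

lemma is_lift_flip:
  assumes m: "m < n" and h: "is_lift (U (Suc m)) g h"
  shows "is_lift (U (Suc m)) g (\<sigma> m \<circ> h)"
proof (rule is_lift_compose_left[OF h fold_map_flip_holomorphic[OF fold[OF m]]])
  show d: "\<sigma> m z \<in> disc" if "z \<in> disc" for z using fold_map_flip_disc[OF fold[OF m] that] .
  show "U (Suc m) (\<sigma> m z) = U (Suc m) z" if "z \<in> disc" for z
    using fold_map_fibre[OF fold[OF m] that d[OF that]] by simp
qed

lemma lifts_to_Suc:
  assumes "m < n" "lifts_to (U (Suc m)) g x y"
  shows "lifts_to (U m) g (f m x) (f m y)"
  using assms is_lift_Suc unfolding lifts_to_def by (metis pathfinish_compose pathstart_compose)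

text \<open>Each fold has fibres of at most two points. Finiteness is what keeps the disc path
  connected after the points over the critical values are removed.\<close>

lemma finite_preimage:
  assumes "m \<le> n" "finite A"
  shows "finite {z \<in> disc. U m z \<in> A}"
  using assms(1)
proof (induction m)
  case 0
  have "finite {z \<in> disc. z \<in> A}" by (rule finite_subset[OF _ assms(2)]) auto
  then show ?case by simp
next
  case (Suc m)
  have F: "fold_map (f m) (c m) (\<sigma> m) (v m)" using fold Suc.prems by simp
  have fib: "finite {z \<in> disc. f m z = b}" for b
  proof (cases "\<exists>a\<in>disc. f m a = b")
    case True
    then obtain a where a: "a \<in> disc" "f m a = b" by blast
    have "{z \<in> disc. f m z = b} \<subseteq> {a, \<sigma> m a}"
    proof
      fix z assume "z \<in> {z \<in> disc. f m z = b}"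
      then show "z \<in> {a, \<sigma> m a}" using a fold_map_fibre[OF F a(1), of z] by simp
    qed
    then show ?thesis by (rule finite_subset) simp
  next
    case False
    then have "{z \<in> disc. f m z = b} = {}" by blast
    then show ?thesis by (simp only: finite.emptyI)
  qed
  have "{z \<in> disc. U (Suc m) z \<in> A} \<subseteq> (\<Union>b\<in>{z \<in> disc. U m z \<in> A}. {z \<in> disc. f m z = b})"
    using fold_map_in_disc[OF F] by auto
  moreover have "finite (\<Union>b\<in>{z \<in> disc. U m z \<in> A}. {z \<in> disc. f m z = b})"
    using Suc fib by (intro finite_UN_I) auto
  ultimately show ?case by (rule finite_subset)
qed

lemma U_section_unique:
  assumes m: "m \<le> n"
    and s: "s holomorphic_on ball w r" "s ` ball w r \<subseteq> disc" "\<And>z. z \<in> ball w r \<Longrightarrow> U m (s z) = z"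
    and t: "t holomorphic_on ball w r" "t ` ball w r \<subseteq> disc" "\<And>z. z \<in> ball w r \<Longrightarrow> U m (t z) = z"
    and a: "a \<in> ball w r" "s a = t a" and z: "z \<in> ball w r"
  shows "s z = t z"
  using section_unique[OF U_holomorphic[OF m] open_ball open_ball connected_ball s t a z] .

text \<open>Let the lift of the approach path from \<open>x\<close> end at \<open>x1\<close>. If
  \<open>f m x = y\<close>, then \<open>x1\<close> lies over the branched sheet, the circle leads to
  \<open>\<sigma> m x1\<close>, and the way back is the conjugate lift, ending at
  \<open>\<sigma> m x\<close>. Otherwise the sheet under \<open>x1\<close> avoids
  \<open>v m\<close>, the circle lifts to a closed path, and the way back retraces the way
  out.\<close>

lemma sibling_swap_loop:
  assumes m: "m < n" and y: "y \<in> disc" "U m y = 0"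
  obtains g where "path g" "pathstart g = 0" "pathfinish g = 0" "path_image g \<subseteq> base"
    "\<And>x. x \<in> disc \<Longrightarrow> U (Suc m) x = 0 \<Longrightarrow> lifts_to (U (Suc m)) g x (if f m x = y then \<sigma> m x else x)"
proof -
  have F: "fold_map (f m) (c m) (\<sigma> m) (v m)" using fold m by simp
  have vm: "v m \<in> disc" using fold_map_crit_value[OF F] fold_map_crit_disc[OF F] fold_map_in_disc[OF F] by metis
  have mn: "m \<le> n" "Suc m \<le> n" using m by auto
  have um: "u m \<in> disc" using U_in_disc[OF mn(1) vm] by (simp add: u_def)
  have uinj: "u j \<noteq> u m" if "j < n" "j \<noteq> m" for j
    using inj_values that m unfolding inj_on_def by blast
  have "open (disc - u ` ({..<n} - {m}))" by (intro open_Diff finite_imp_closed) auto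
  moreover have "u m \<in> disc - u ` ({..<n} - {m})" using um uinj by force
  ultimately obtain r where r: "r > 0" "ball (u m) r \<subseteq> disc - u ` ({..<n} - {m})"
    using open_contains_ball by blast
  let ?D = "ball (u m) r"
  have D: "?D \<subseteq> disc" "?D \<inter> u ` {..<m} = {}" using r(2) m by auto
  have Dbase: "z \<in> base" if "z \<in> ?D" "z \<noteq> u m" for z using r(2) that by auto
  have umD: "u m \<in> ?D" using r by simp
  obtain s0 where s0: "s0 holomorphic_on ?D" "s0 ` ?D \<subseteq> disc" "\<And>z. z \<in> ?D \<Longrightarrow> U m (s0 z) = z" "s0 (u m) = v m"
    using U_section[OF mn(1) D vm] umD unfolding u_def by blast
  define \<rho> where "\<rho> = r / 2"
  have \<rho>: "0 < \<rho>" "\<rho> < r" using r by (auto simp: \<rho>_def)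
  define b where "b = u m + of_real \<rho>"
  have bD: "b \<in> ?D" "b \<noteq> u m" using \<rho> by (auto simp: b_def dist_norm)
  define circ where "circ = circlepath (u m) \<rho>"
  have circD: "circ t \<in> ?D" "circ t \<noteq> u m" for t
    using \<rho> by (auto simp: circ_def circlepath dist_norm norm_mult)
  have circ_ends: "pathstart circ = b" "pathfinish circ = b" "circ 0 = b" "circ 1 = b"
    unfolding circ_def b_def by (simp_all only: pathstart_circlepath pathfinish_circlepath) (simp_all add: circlepath)
  let ?W = "disc - {z \<in> disc. U m z \<in> u ` {..<n}}"
  have "path_connected ?W"
    using finite_preimage[OF mn(1), of "u ` {..<n}"]
    by (intro path_connected_open_diff_countable countable_finite) auto
  moreover have "y \<in> ?W" using y zero_value by auto
  moreover have "s0 b \<in> ?W" using subsetD[OF s0(2) imageI[OF bD(1)]] s0(3)[OF bD(1)] Dbase[OF bD] by simp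
  ultimately obtain q where q: "path q" "path_image q \<subseteq> ?W" "pathstart q = y" "pathfinish q = s0 b"
    unfolding path_connected_def by blast
  \<comment> \<open>The approach path is the projection of a path chosen upstairs, so its lift
    starting at \<open>y\<close> is \<open>q\<close> by construction and ends on the sheet
    \<open>s0\<close>.\<close>
  define p where "p = U m \<circ> q"
  have qlift: "is_lift (U m) p q" using q by (auto simp: is_lift_def p_def)
  have p: "path p" "path_image p \<subseteq> base"
  proof -
    show "path p" unfolding p_def
      using q U_holomorphic[OF mn(1)]
      by (intro path_continuous_image) (auto intro: holomorphic_on_imp_continuous_on holomorphic_on_subset)
    show "path_image p \<subseteq> base"
      using q(2) U_in_disc[OF mn(1)] unfolding p_def path_image_compose by auto
  qed
  have p_ends: "pathstart p = 0" "pathfinish p = b"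
    using q y s0(3)[OF bD(1)] by (auto simp: p_def pathstart_compose pathfinish_compose)
  define g where "g = p +++ (circ +++ reversepath p)"
  show ?thesis
  proof
    show "path g" using p p_ends circ_ends by (simp add: g_def) (simp add: circ_def)
    show "pathstart g = 0" "pathfinish g = 0" using p_ends by (auto simp: g_def)
    have "path_image circ \<subseteq> base" using circD Dbase by (auto simp: path_image_def simp del: mem_ball Diff_iff)
    then show "path_image g \<subseteq> base"
      unfolding g_def using p by (intro subset_path_image_join) (auto simp: path_image_reversepath)
    fix x assume x: "x \<in> disc" "U (Suc m) x = 0"
    obtain k where k: "is_lift (U (Suc m)) p k" "pathstart k = x"
      using lift_exists[OF mn(2) p x(1)] x(2) p_ends(1) by metis
    define x1 where "x1 = pathfinish k"
    have x1: "x1 \<in> disc" "U m (f m x1) = b"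
      using is_lift_ends[OF k(1)] p_ends by (auto simp: x1_def)
    have fk: "is_lift (U m) p (f m \<circ> k)" using is_lift_Suc[OF m k(1)] .
    have fk_ends: "(f m \<circ> k) 0 = f m x" "(f m \<circ> k) 1 = f m x1"
      using k(2) by (auto simp: x1_def pathstart_def pathfinish_def)
    have q_ends: "q 0 = y" "q 1 = s0 b" using q by (auto simp: pathstart_def pathfinish_def)
    \<comment> \<open>Uniqueness of lifts from the start point gives one direction and from the end
      point the other.\<close>
    have y_iff: "f m x = y \<longleftrightarrow> f m x1 = s0 b"
      using lift_unique[OF mn(1) p fk qlift, of 0 1] lift_unique[OF mn(1) p fk qlift, of 1 0] fk_ends q_ends
      by auto
    have px: "lifts_to (U (Suc m)) p x x1" using k by (auto simp: lifts_to_def x1_def)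
    show "lifts_to (U (Suc m)) g x (if f m x = y then \<sigma> m x else x)"
    proof (cases "f m x = y")
      case True
      then have fx1: "f m x1 = s0 (u m + of_real \<rho>)" using y_iff by (simp add: b_def)
      have inj: "inj_on s0 ?D" using s0(3) by (metis inj_onI)
      obtain h where h: "path h" "path_image h \<subseteq> disc" "pathstart h = x1" "pathfinish h = \<sigma> m x1"
          "\<And>t. t \<in> {0..1} \<Longrightarrow> f m (h t) = s0 (circ t)"
        using fold_map_lift_circle[OF F s0(1,2) inj s0(4) \<rho> x1(1) fx1] unfolding circ_def by blast
      have "is_lift (U (Suc m)) circ h" using h circD s0(3) by (auto simp: is_lift_def simp del: mem_ball)
      then have "lifts_to (U (Suc m)) circ x1 (\<sigma> m x1)" using h unfolding lifts_to_def by blast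
      moreover have "lifts_to (U (Suc m)) p (\<sigma> m x) (\<sigma> m x1)"
        using is_lift_flip[OF m k(1)] k(2) unfolding lifts_to_def x1_def by (metis pathfinish_compose pathstart_compose)
      ultimately show ?thesis
        unfolding g_def using px True by (auto intro!: lifts_to_join intro: lifts_to_reverse)
    next
      case False
      then have ne: "f m x1 \<noteq> s0 b" using y_iff by simp
      have "U m (f m x1) \<in> ?D" using x1 bD by simp
      then obtain s where s: "s holomorphic_on ?D" "s ` ?D \<subseteq> disc" "\<And>z. z \<in> ?D \<Longrightarrow> U m (s z) = z" "s b = f m x1"
        using U_section[OF mn(1) D fold_map_in_disc[OF F x1(1)]] x1(2) by auto
      \<comment> \<open>A point where \<open>s\<close> takes the value \<open>v m\<close> must be
        \<open>u m\<close>, where \<open>s0\<close> takes it too; then \<open>s\<close> and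
        \<open>s0\<close> would agree on the whole disc, against \<open>ne\<close>.\<close>
      have "v m \<notin> s ` ?D"
      proof
        assume "v m \<in> s ` ?D"
        then obtain z where z: "v m = s z" "z \<in> ?D" by (rule imageE)
        then have "z = u m" using s(3)[OF z(2)] by (simp add: u_def)
        then have "s (u m) = s0 (u m)" using z s0(4) by simp
        then have "s b = s0 b" using U_section_unique[OF mn(1) s(1-3) s0(1-3) umD _ bD(1)] by blast
        then show False using ne s(4) by simp
      qed
      then obtain s' where s': "s' holomorphic_on ?D" "s' ` ?D \<subseteq> disc" "\<And>z. z \<in> ?D \<Longrightarrow> f m (s' z) = s z" "s' b = x1"
        using fold_map_lift_section[OF F s(1,2) _ bD(1) x1(1) s(4)[symmetric]] by blast
      have "is_lift (U (Suc m)) circ (s' \<circ> circ)"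
        unfolding is_lift_def
      proof (intro conjI ballI)
        show "path (s' \<circ> circ)"
          using circD s'(1) by (intro path_continuous_image)
            (auto simp: circ_def path_image_def simp del: mem_ball intro!: holomorphic_on_imp_continuous_on intro: holomorphic_on_subset)
        show "path_image (s' \<circ> circ) \<subseteq> disc" using s'(2) circD by (auto simp: path_image_def simp del: mem_ball)
        show "U (Suc m) ((s' \<circ> circ) t) = circ t" for t using s'(3) s(3) circD by simp
      qed
      then have "lifts_to (U (Suc m)) circ x1 x1"
        unfolding lifts_to_def using s'(4) circ_ends by (intro exI[of _ "s' \<circ> circ"]) (simp add: pathstart_compose pathfinish_compose)
      then show ?thesis
        unfolding g_def using px False by (auto intro!: lifts_to_join intro: lifts_to_reverse)
    qed
  qed
qed

end

section \<open>Monodromy as path lifting\<close>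

definition zeros_in_disc :: "(complex \<Rightarrow> complex) \<Rightarrow> complex set" where
  "zeros_in_disc F = {z \<in> disc. F z = 0}"

context fold_chain
begin

lemma crit_points_cong:
  assumes "\<And>z. z \<in> disc \<Longrightarrow> B z = U n z"
  shows "crit_points B = crit_points (U n)"
proof -
  have "deriv B z = deriv (U n) z" if "z \<in> disc" for z
    using assms that by (intro deriv_cong_ev eventually_nhds_in_open[THEN eventually_mono, of disc]) auto
  then show ?thesis unfolding crit_points_def by (intro Collect_cong) auto
qed

lemma crit_values_eq:
  assumes B: "\<And>z. z \<in> disc \<Longrightarrow> B z = U n z"
  shows "B ` crit_points B = u ` {..<n}"
proof -
  have "B ` crit_points (U n) = U n ` crit_points (U n)"
  proof (rule image_cong[OF refl])
    show "B z = U n z" if "z \<in> crit_points (U n)" for z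
      using that by (intro B) (simp add: crit_points_def)
  qed
  then have "B ` crit_points B = U n ` crit_points (U n)" using crit_points_cong[OF B] by simp
  then show ?thesis using U_critical_values[of n] by simp
qed

end

locale blaschke_tower = fold_tower +
  fixes B :: "complex \<Rightarrow> complex"
  assumes B_eq: "\<And>z. z \<in> disc \<Longrightarrow> B z = U n z"
begin

lemma mono_loops_iff:
  "g \<in> mono_loops B \<longleftrightarrow> path g \<and> pathstart g = 0 \<and> pathfinish g = 0 \<and> path_image g \<subseteq> base"
proof -
  have "B ` crit_points B = u ` {..<n}" by (rule crit_values_eq) (rule B_eq)
  then show ?thesis unfolding mono_loops_def by simp
qed

lemma open_base: "open base"
  by (rule open_disc_minus_values)

text \<open>Each germ is evaluated at its own centre. Near time \<open>s\<close> the germs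
  \<open>F t\<close> and \<open>F s\<close> agree around \<open>g t\<close>, so
  \<open>F t (g t) = F s (g t)\<close>, and continuity is inherited from the single function
  \<open>F s\<close>.\<close>

lemma inv_continuation_is_lift:
  assumes g: "path g" and F: "inv_continuation B g F"
  shows "is_lift (U n) g (\<lambda>t. F t (g t))"
proof -
  have loc: "\<exists>r>0. F t holomorphic_on ball (g t) r \<and> (\<forall>w\<in>ball (g t) r. F t w \<in> disc \<and> B (F t w) = w)"
    if "t \<in> {0..1}" for t using F that unfolding inv_continuation_def by blast
  have mem: "F t (g t) \<in> disc" "B (F t (g t)) = g t" if "t \<in> {0..1}" for t
    using loc[OF that] by (meson centre_in_ball)+
  have "((\<lambda>t. F t (g t)) \<longlongrightarrow> F s (g s)) (at s within {0..1})" if s: "s \<in> {0..1}" for s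
  proof -
    obtain r where r: "r > 0" "F s holomorphic_on ball (g s) r" using loc[OF s] by blast
    have "isCont (F s) (g s)"
      using holomorphic_on_imp_continuous_on[OF r(2)] r(1) by (simp add: continuous_on_eq_continuous_at)
    moreover have "(g \<longlongrightarrow> g s) (at s within {0..1})"
      using g s unfolding path_def continuous_on_def by blast
    ultimately have lim: "((\<lambda>t. F s (g t)) \<longlongrightarrow> F s (g s)) (at s within {0..1})"
      by (rule isCont_tendsto_compose)
    obtain d where d: "d > 0" "\<And>t. t \<in> {0..1} \<Longrightarrow> \<bar>t - s\<bar> < d \<Longrightarrow> \<forall>\<^sub>F w in nhds (g t). F t w = F s w"
      using F s unfolding inv_continuation_def by meson
    have "F s (g t) = F t (g t)" if "t \<in> {0..1}" "\<bar>t - s\<bar> < d" for t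
      using eventually_nhds_x_imp_x[OF d(2)[OF that]] by simp
    then have "\<forall>\<^sub>F t in at s within {0..1}. F s (g t) = F t (g t)"
      unfolding eventually_at using d(1) by (auto simp: dist_real_def)
    then show ?thesis using lim tendsto_cong by fast
  qed
  then have "path (\<lambda>t. F t (g t))" unfolding path_def continuous_on_def by blast
  then show ?thesis
    using mem B_eq unfolding is_lift_def path_image_def by (auto simp del: mem_ball)
qed

text \<open>\<open>F t\<close> is a section near \<open>g t\<close> through \<open>h t\<close>. For
  \<open>t\<close> near \<open>s\<close>, both \<open>h t\<close> and \<open>F s (g t)\<close> lie
  over \<open>g t\<close> in a small ball around \<open>h s\<close> on which \<open>U n\<close> is
  injective. So they coincide, and uniqueness of sections makes the germs agree.\<close>

lemma is_lift_inv_continuation: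
  assumes g: "path g" "path_image g \<subseteq> base" and h: "is_lift (U n) g h"
  obtains F where "inv_continuation B g F" "\<And>t. t \<in> {0..1} \<Longrightarrow> F t (g t) = h t"
proof -
  define local_sect where "local_sect t r s \<longleftrightarrow> r > 0 \<and> s holomorphic_on ball (g t) r \<and>
      s ` ball (g t) r \<subseteq> disc \<and> (\<forall>z\<in>ball (g t) r. U n (s z) = z) \<and> s (g t) = h t" for t r s
  have ex: "\<exists>r s. local_sect t r s" if t: "t \<in> {0..1}" for t
  proof -
    have "g t \<in> base" using g(2) t unfolding path_image_def by blast
    then obtain r where r: "r > 0" "ball (g t) r \<subseteq> base" using open_base open_contains_ball by blast
    have b: "ball (g t) r \<subseteq> disc" "ball (g t) r \<inter> u ` {..<n} = {}" using r(2) by blast+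
    have ht: "h t \<in> disc" "U n (h t) = g t" using is_lift_mem[OF h t] h t by (auto simp: is_lift_def)
    have "U n (h t) \<in> ball (g t) r" using ht r by simp
    then show ?thesis using U_section[OF order_refl b ht(1)] ht(2) r(1) unfolding local_sect_def by auto
  qed
  have "\<forall>t\<in>{0..1}. \<exists>F r. local_sect t r F" using ex by blast
  then obtain F where F: "\<forall>t\<in>{0..1}. \<exists>r. local_sect t r (F t)" by (rule bchoice[THEN exE])
  then obtain R where RF: "\<forall>t\<in>{0..1}. local_sect t (R t) (F t)" by (rule bchoice[THEN exE])
  have R: "R t > 0" and hol: "F t holomorphic_on ball (g t) (R t)" and sub: "F t ` ball (g t) (R t) \<subseteq> disc"
    and right_inv': "\<forall>z\<in>ball (g t) (R t). U n (F t z) = z" and start: "F t (g t) = h t"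
    if "t \<in> {0..1}" for t
    using bspec[OF RF that] unfolding local_sect_def by simp_all
  note right_inv = right_inv'[THEN bspec]
  have "inv_continuation B g F"
    unfolding inv_continuation_def
  proof (intro conjI ballI)
    fix t :: real assume t: "t \<in> {0..1}"
    show "\<exists>r>0. F t holomorphic_on ball (g t) r \<and> (\<forall>w\<in>ball (g t) r. F t w \<in> disc \<and> B (F t w) = w)"
    proof (intro exI[of _ "R t"] conjI ballI)
      fix w assume w: "w \<in> ball (g t) (R t)"
      show "F t w \<in> disc" using subsetD[OF sub[OF t] imageI[OF w]] .
      then show "B (F t w) = w" using B_eq right_inv[OF t w] by simp
    qed (use R[OF t] hol[OF t] in auto)
  next
    fix s :: real assume s: "s \<in> {0..1}"
    have gs: "g s \<in> ball (g s) (R s)" using R[OF s] by simp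
    obtain \<rho> where \<rho>: "\<rho> > 0" "inj_on (U n) (ball (F s (g s)) \<rho>)"
      using section_local_inj[OF U_holomorphic[OF order_refl] open_ball hol[OF s] open_ball sub[OF s] right_inv[OF s] gs]
      by blast
    let ?N = "ball (g s) (R s) \<inter> F s -` ball (h s) \<rho>"
    have "open ?N"
      using continuous_open_preimage[OF holomorphic_on_imp_continuous_on[OF hol[OF s]] open_ball open_ball] .
    moreover have "g s \<in> ?N" using gs \<rho>(1) start[OF s] by simp
    moreover have "(g \<longlongrightarrow> g s) (at s within {0..1})"
      using g(1) s unfolding path_def continuous_on_def by blast
    ultimately have "\<forall>\<^sub>F t in at s within {0..1}. g t \<in> ?N" by (metis topological_tendstoD)
    moreover have "\<forall>\<^sub>F t in at s within {0..1}. h t \<in> ball (h s) \<rho>"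
    proof (rule topological_tendstoD)
      show "(h \<longlongrightarrow> h s) (at s within {0..1})"
        using h s unfolding is_lift_def path_def continuous_on_def by blast
    qed (use \<rho>(1) in auto)
    ultimately have "\<forall>\<^sub>F t in at s within {0..1}. g t \<in> ?N \<and> h t \<in> ball (h s) \<rho>"
      by (rule eventually_conj)
    then obtain d where d: "d > 0"
      "\<And>t. t \<in> {0..1} \<Longrightarrow> t \<noteq> s \<Longrightarrow> dist t s < d \<Longrightarrow> g t \<in> ?N \<and> h t \<in> ball (h s) \<rho>"
      unfolding eventually_at by blast
    show "\<exists>\<delta>>0. \<forall>t\<in>{0..1}. \<bar>t - s\<bar> < \<delta> \<longrightarrow> (\<forall>\<^sub>F w in nhds (g t). F t w = F s w)"
    proof (intro exI[of _ d] conjI ballI impI)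
      fix t assume t: "t \<in> {0..1}" "\<bar>t - s\<bar> < d"
      show "\<forall>\<^sub>F w in nhds (g t). F t w = F s w"
      proof (cases "t = s")
        case False
        then have N: "g t \<in> ball (g s) (R s)" "F s (g t) \<in> ball (h s) \<rho>" "h t \<in> ball (h s) \<rho>"
          using d(2)[OF t(1)] t(2) by (auto simp: dist_real_def)
        have gt: "g t \<in> ball (g t) (R t)" using R[OF t(1)] by simp
        have "U n (F s (g t)) = U n (F t (g t))" using right_inv[OF s N(1)] right_inv[OF t(1) gt] by simp
        then have agree: "F t (g t) = F s (g t)"
          using \<rho>(2) N start[OF s] start[OF t(1)] by (auto dest!: inj_onD simp del: mem_ball)
        have "open (ball (g t) (R t) \<inter> ball (g s) (R s))" by (intro open_Int open_ball)
        then obtain e where e: "e > 0" "ball (g t) e \<subseteq> ball (g t) (R t) \<inter> ball (g s) (R s)"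
          using gt N(1) open_contains_ball by (metis IntI)
        then have sub1: "ball (g t) e \<subseteq> ball (g t) (R t)" and sub2: "ball (g t) e \<subseteq> ball (g s) (R s)" by auto
        have "F t w = F s w" if "w \<in> ball (g t) e" for w
        proof (rule U_section_unique[OF order_refl, where s = "F t" and t = "F s" and w = "g t" and r = e and a = "g t"])
          show "F t holomorphic_on ball (g t) e" "F s holomorphic_on ball (g t) e"
            using hol[OF t(1)] hol[OF s] sub1 sub2 holomorphic_on_subset by blast+
          show "F t ` ball (g t) e \<subseteq> disc" "F s ` ball (g t) e \<subseteq> disc"
            using subset_trans[OF image_mono[OF sub1, of "F t"] sub[OF t(1)]]
              subset_trans[OF image_mono[OF sub2, of "F s"] sub[OF s]] .
          show "U n (F t z) = z" "U n (F s z) = z" if "z \<in> ball (g t) e" for z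
            using right_inv[OF t(1) subsetD[OF sub1 that]] right_inv[OF s subsetD[OF sub2 that]] .
        qed (use e(1) agree that in auto)
        then show ?thesis
          using eventually_nhds_in_open[of "ball (g t) e" "g t"] e(1) by (auto elim: eventually_mono)
      qed simp
    qed (fact d(1))
  qed
  then show ?thesis using that start by blast
qed

abbreviation Z :: "complex set" where "Z \<equiv> zeros_in_disc (U n)"

lemma mono_perm_outside: "x \<notin> Z \<Longrightarrow> mono_perm B g x = x"
  using B_eq by (auto simp: mono_perm_def zeros_in_disc_def)

text \<open>Since the loop begins and ends at 0, the values \<open>F 0 0\<close> and
  \<open>F 1 0\<close> are the end points of the corresponding lift, so unique path lifting
  justifies the definite description.\<close>

lemma mono_perm_lifts_to:
  assumes g: "g \<in> mono_loops B" and x: "x \<in> Z"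
  shows "lifts_to (U n) g x (mono_perm B g x)"
proof -
  have g': "path g" "path_image g \<subseteq> base" "g 0 = 0" "g 1 = 0"
    using g by (auto simp: mono_loops_iff pathstart_def pathfinish_def)
  have x': "x \<in> disc" "U n x = 0" using x by (auto simp: zeros_in_disc_def)
  have iff: "(\<exists>F. inv_continuation B g F \<and> F 0 0 = x \<and> F 1 0 = y) \<longleftrightarrow> lifts_to (U n) g x y" for y
  proof
    assume "\<exists>F. inv_continuation B g F \<and> F 0 0 = x \<and> F 1 0 = y"
    then obtain F where F: "inv_continuation B g F" "F 0 0 = x" "F 1 0 = y" by blast
    show "lifts_to (U n) g x y"
      unfolding lifts_to_def using inv_continuation_is_lift[OF g'(1) F(1)] F g'
      by (intro exI[of _ "\<lambda>t. F t (g t)"]) (simp add: pathstart_def pathfinish_def)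
  next
    assume "lifts_to (U n) g x y"
    then obtain h where h: "is_lift (U n) g h" "h 0 = x" "h 1 = y"
      unfolding lifts_to_def pathstart_def pathfinish_def by blast
    obtain F where F: "inv_continuation B g F" "\<And>t. t \<in> {0..1} \<Longrightarrow> F t (g t) = h t"
      using is_lift_inv_continuation[OF g'(1,2) h(1)] by blast
    show "\<exists>F. inv_continuation B g F \<and> F 0 0 = x \<and> F 1 0 = y"
      using F(1) F(2)[of 0] F(2)[of 1] h g' by auto
  qed
  obtain y where y: "lifts_to (U n) g x y"
    using lifts_to_exists[OF order_refl g'(1,2) x'(1)] x'(2) g'(3) unfolding pathstart_def by metis
  have "mono_perm B g x = (THE y. lifts_to (U n) g x y)"
    using x' B_eq unfolding mono_perm_def iff by simp
  also have "\<dots> = y"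
    using y lifts_to_unique[OF order_refl g'(1,2)] by (intro the_equality) auto
  finally show ?thesis using y by simp
qed

end

section \<open>Automorphisms of rooted trees\<close>

text \<open>Permutations of \<open>Z\<close> respecting a nested family of partitions given by the fibres of
  \<open>\<kappa> 0, \<dots>, \<kappa> n\<close>, i.e. automorphisms of a rooted tree with leaves \<open>Z\<close>.\<close>

definition tree_auts :: "nat \<Rightarrow> (nat \<Rightarrow> 'a \<Rightarrow> 'b) \<Rightarrow> 'a set \<Rightarrow> ('a \<Rightarrow> 'a) set" where
  "tree_auts n \<kappa> Z = {p. (\<forall>x. x \<notin> Z \<longrightarrow> p x = x) \<and> (\<forall>x\<in>Z. p x \<in> Z) \<and>
     (\<forall>m\<le>n. \<forall>x\<in>Z. \<forall>y\<in>Z. \<kappa> m (p x) = \<kappa> m (p y) \<longleftrightarrow> \<kappa> m x = \<kappa> m y)}"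

lemma tree_autsI:
  assumes "\<And>x. x \<notin> Z \<Longrightarrow> p x = x" "\<And>x. x \<in> Z \<Longrightarrow> p x \<in> Z"
    "\<And>m x y. m \<le> n \<Longrightarrow> x \<in> Z \<Longrightarrow> y \<in> Z \<Longrightarrow> \<kappa> m (p x) = \<kappa> m (p y) \<longleftrightarrow> \<kappa> m x = \<kappa> m y"
  shows "p \<in> tree_auts n \<kappa> Z"
  using assms unfolding tree_auts_def by blast

lemma tree_autsD:
  assumes "p \<in> tree_auts n \<kappa> Z"
  shows "\<And>x. x \<notin> Z \<Longrightarrow> p x = x" "\<And>x. x \<in> Z \<Longrightarrow> p x \<in> Z"
    "\<And>m x y. m \<le> n \<Longrightarrow> x \<in> Z \<Longrightarrow> y \<in> Z \<Longrightarrow> \<kappa> m (p x) = \<kappa> m (p y) \<longleftrightarrow> \<kappa> m x = \<kappa> m y"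
  using assms unfolding tree_auts_def by blast+

lemma tree_auts_transport:
  assumes p: "p \<in> tree_auts n \<kappa> Z"
    and L: "\<And>x. x \<in> Z' \<Longrightarrow> L' x \<in> Z" "\<And>x. x \<in> Z \<Longrightarrow> L x \<in> Z'"
    and \<kappa>: "\<And>m x y. m \<le> n \<Longrightarrow> x \<in> Z \<Longrightarrow> y \<in> Z \<Longrightarrow> \<kappa>' m (L x) = \<kappa>' m (L y) \<longleftrightarrow> \<kappa> m x = \<kappa> m y"
    and inv: "\<And>y. y \<in> Z' \<Longrightarrow> L (L' y) = y"
  shows "(\<lambda>y. if y \<in> Z' then L (p (L' y)) else y) \<in> tree_auts n \<kappa>' Z'"
proof (rule tree_autsI)
  note p = tree_autsD[OF p]
  fix m x y assume m: "m \<le> n" and x: "x \<in> Z'" and y: "y \<in> Z'"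
  have "\<kappa>' m (L (p (L' x))) = \<kappa>' m (L (p (L' y))) \<longleftrightarrow> \<kappa> m (p (L' x)) = \<kappa> m (p (L' y))"
    using \<kappa>[OF m] p(2) L(1) x y by blast
  also have "\<dots> \<longleftrightarrow> \<kappa> m (L' x) = \<kappa> m (L' y)" using p(3)[OF m] L(1) x y by blast
  also have "\<dots> \<longleftrightarrow> \<kappa>' m x = \<kappa>' m y"
    using \<kappa>[OF m L(1)[OF x] L(1)[OF y]] inv x y by simp
  finally show "\<kappa>' m (if x \<in> Z' then L (p (L' x)) else x) = \<kappa>' m (if y \<in> Z' then L (p (L' y)) else y) \<longleftrightarrow> \<kappa>' m x = \<kappa>' m y"
    using x y by simp
qed (use tree_autsD[OF p] L in auto)

text \<open>The isomorphism is conjugation by \<open>L\<close>, extended by the identity outside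
  \<open>Z'\<close>.\<close>

lemma tree_auts_iso:
  assumes bij: "bij_betw L Z Z'"
    and \<kappa>: "\<And>m x y. m \<le> n \<Longrightarrow> x \<in> Z \<Longrightarrow> y \<in> Z \<Longrightarrow> \<kappa>' m (L x) = \<kappa>' m (L y) \<longleftrightarrow> \<kappa> m x = \<kappa> m y"
  shows "\<lparr>carrier = tree_auts n \<kappa> Z, mult = (\<circ>), one = id\<rparr> \<cong> \<lparr>carrier = tree_auts n \<kappa>' Z', mult = (\<circ>), one = id\<rparr>"
    (is "?G \<cong> ?H")
proof -
  define L' where "L' = inv_into Z L"
  have L: "L x \<in> Z'" "L' (L x) = x" if "x \<in> Z" for x
    using bij that unfolding L'_def by (auto simp: bij_betw_def)
  have L': "L' y \<in> Z" "L (L' y) = y" if "y \<in> Z'" for y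
    using bij that unfolding L'_def by (auto simp: bij_betw_def inv_into_into f_inv_into_f)
  define \<Phi> where "\<Phi> p = (\<lambda>y. if y \<in> Z' then L (p (L' y)) else y)" for p
  define \<Psi> where "\<Psi> q = (\<lambda>x. if x \<in> Z then L' (q (L x)) else x)" for q
  have \<Phi>: "\<Phi> p \<in> tree_auts n \<kappa>' Z'" if "p \<in> tree_auts n \<kappa> Z" for p
    unfolding \<Phi>_def using that L L' \<kappa> by (intro tree_auts_transport[where \<kappa> = \<kappa>]) auto
  have \<kappa>2: "\<kappa> m (L' x) = \<kappa> m (L' y) \<longleftrightarrow> \<kappa>' m x = \<kappa>' m y" if "m \<le> n" "x \<in> Z'" "y \<in> Z'" for m x y
    using \<kappa>[OF that(1) L'(1)[OF that(2)] L'(1)[OF that(3)]] L'(2) that by simp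
  have \<Psi>: "\<Psi> q \<in> tree_auts n \<kappa> Z" if "q \<in> tree_auts n \<kappa>' Z'" for q
    unfolding \<Psi>_def using that L L' \<kappa>2 by (intro tree_auts_transport[where \<kappa> = \<kappa>']) auto
  have "\<Phi> \<in> hom ?G ?H"
  proof (rule homI)
    fix p q assume "p \<in> carrier ?G" "q \<in> carrier ?G"
    then have q: "q \<in> tree_auts n \<kappa> Z" by simp
    have "\<Phi> (p \<circ> q) y = (\<Phi> p \<circ> \<Phi> q) y" for y
    proof (cases "y \<in> Z'")
      case True
      then have "q (L' y) \<in> Z" using tree_autsD(2)[OF q] L' by blast
      then show ?thesis using L True by (simp add: \<Phi>_def)
    qed (simp add: \<Phi>_def)
    then have "\<Phi> (p \<circ> q) = \<Phi> p \<circ> \<Phi> q" by blast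
    then show "\<Phi> (p \<otimes>\<^bsub>?G\<^esub> q) = \<Phi> p \<otimes>\<^bsub>?H\<^esub> \<Phi> q" by simp
  qed (use \<Phi> in simp)
  moreover have "bij_betw \<Phi> (carrier ?G) (carrier ?H)"
  proof (rule bij_betw_byWitness[where f' = \<Psi>])
    show "\<forall>p\<in>carrier ?G. \<Psi> (\<Phi> p) = p"
    proof (intro ballI ext)
      fix p x assume "p \<in> carrier ?G"
      then have "p \<in> tree_auts n \<kappa> Z" by simp
      from tree_autsD(1,2)[OF this, of x] show "\<Psi> (\<Phi> p) x = p x"
        using L by (cases "x \<in> Z") (simp_all add: \<Phi>_def \<Psi>_def)
    qed
    show "\<forall>q\<in>carrier ?H. \<Phi> (\<Psi> q) = q"
    proof (intro ballI ext)
      fix q y assume "q \<in> carrier ?H"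
      then have "q \<in> tree_auts n \<kappa>' Z'" by simp
      from tree_autsD(1,2)[OF this, of y] show "\<Phi> (\<Psi> q) y = q y"
        using L' by (cases "y \<in> Z'") (simp_all add: \<Phi>_def \<Psi>_def)
    qed
  qed (use \<Phi> \<Psi> in auto)
  ultimately show ?thesis unfolding is_iso_def iso_def by blast
qed

text \<open>The blocks at depth \<open>m\<close> are the words with a common prefix of length
  \<open>m\<close>. Preserving the blocks at depth 1 in both directions means acting on the head by
  a fixed bit; the deeper blocks then say that the action on the tails below each head is of the
  same kind for \<open>k\<close>.\<close>

lemma wreath_Z2_carrier_eq: "wreath_Z2_carrier n = tree_auts n take {xs. length xs = n}"
proof (induction n)
  case 0
  have "p = id" if "\<And>xs. xs \<noteq> [] \<Longrightarrow> p xs = xs" "p [] = []" for p :: "bool list \<Rightarrow> bool list"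
    using that by (metis eq_id_iff)
  then show ?case by (auto simp: tree_auts_def)
next
  case (Suc k)
  have IH: "q \<in> wreath_Z2_carrier k \<longleftrightarrow> q \<in> tree_auts k take {xs. length xs = k}" for q using Suc by simp
  show ?case
  proof (intro equalityI subsetI)
    fix p assume "p \<in> wreath_Z2_carrier (Suc k)"
    then obtain c q0 q1 where q: "q0 \<in> tree_auts k take {xs. length xs = k}" "q1 \<in> tree_auts k take {xs. length xs = k}"
      and p: "\<And>xs. p xs = (if length xs = Suc k then (hd xs \<noteq> c) # (if hd xs then q1 (tl xs) else q0 (tl xs)) else xs)"
      using IH by auto
    define q where "q b = (if b then q1 else q0)" for b
    have qb: "q b \<in> tree_auts k take {xs. length xs = k}" for b using q by (simp add: q_def)
    have pq: "p (b # xs) = (b \<noteq> c) # q b xs" if "length xs = k" for b xs using that by (simp add: p q_def)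
    note qD = tree_autsD[OF qb]
    show "p \<in> tree_auts (Suc k) take {xs. length xs = Suc k}"
    proof (rule tree_autsI)
      show "p xs = xs" if "xs \<notin> {xs. length xs = Suc k}" for xs using that p by simp
      show "p xs \<in> {xs. length xs = Suc k}" if "xs \<in> {xs. length xs = Suc k}" for xs
        using that qD(2) by (cases xs) (auto simp: pq)
      fix m and xs ys :: "bool list"
      assume m: "m \<le> Suc k" and "xs \<in> {xs. length xs = Suc k}" "ys \<in> {xs. length xs = Suc k}"
      then obtain a as b bs where xs: "xs = a # as" "length as = k" and ys: "ys = b # bs" "length bs = k"
        by (auto simp: length_Suc_conv)
      show "take m (p xs) = take m (p ys) \<longleftrightarrow> take m xs = take m ys"
      proof (cases m)
        case (Suc m')
        then show ?thesis using qD(3)[of m' as bs b] m xs ys by (cases "a = b") (auto simp: pq)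
      qed simp
    qed
  next
    fix p :: "bool list \<Rightarrow> bool list"
    assume p: "p \<in> tree_auts (Suc k) take {xs. length xs = Suc k}"
    note pD = tree_autsD[OF p]
    have plen: "length (p xs) = Suc k" if "length xs = Suc k" for xs using pD(2) that by simp
    have take_iff: "take m (p xs) = take m (p ys) \<longleftrightarrow> take m xs = take m ys"
      if "m \<le> Suc k" "length xs = Suc k" "length ys = Suc k" for m xs ys using pD(3) that by simp
    \<comment> \<open>The all-\<open>False\<close> word is an arbitrary witness: the heads of all
      images are determined by this one, since there are only two possible heads.\<close>
    define c where "c = hd (p (False # replicate k False))"
    have hd: "hd (p (b # xs)) \<longleftrightarrow> b \<noteq> c" if "length xs = k" for b xs
    proof -
      let ?ys = "False # replicate k False"
      have "take 1 (p (b # xs)) = take 1 (p ?ys) \<longleftrightarrow> take 1 (b # xs) = take 1 ?ys"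
        using that by (intro take_iff) auto
      moreover have "p (b # xs) \<noteq> []" "p ?ys \<noteq> []" using plen[of "b # xs"] plen[of ?ys] that by auto
      ultimately have "hd (p (b # xs)) = c \<longleftrightarrow> b = False" unfolding c_def by (simp add: take_Suc)
      then show ?thesis by auto
    qed
    define q where "q b = (\<lambda>xs. if length xs = k then tl (p (b # xs)) else xs)" for b
    have pq: "p (b # xs) = (b \<noteq> c) # q b xs" if "length xs = k" for b xs
    proof -
      have "p (b # xs) \<noteq> []" using plen[of "b # xs"] that by auto
      then show ?thesis using hd[OF that, of b] that by (cases "p (b # xs)") (auto simp: q_def)
    qed
    have "q b \<in> tree_auts k take {xs. length xs = k}" for b
    proof (rule tree_autsI)
      show "q b xs \<in> {xs. length xs = k}" if "xs \<in> {xs. length xs = k}" for xs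
        using plen[of "b # xs"] that by (simp add: q_def)
      fix m and xs ys :: "bool list" assume "m \<le> k" "xs \<in> {xs. length xs = k}" "ys \<in> {xs. length xs = k}"
      then show "take m (q b xs) = take m (q b ys) \<longleftrightarrow> take m xs = take m ys"
        using take_iff[of "Suc m" "b # xs" "b # ys"] by (simp add: pq)
    qed (simp add: q_def)
    moreover have "p xs = (if length xs = Suc k then (hd xs \<noteq> c) # (if hd xs then q True (tl xs) else q False (tl xs)) else xs)" for xs
    proof (cases xs)
      case Nil
      then show ?thesis using pD(1) by simp
    next
      case (Cons b bs)
      then show ?thesis using pD(1)[of xs] pq[of bs b] by auto
    qed
    ultimately show "p \<in> wreath_Z2_carrier (Suc k)" using IH by auto
  qed
qed

section \<open>The monodromy group\<close>

context fold_chain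
begin

text \<open>The ancestor at depth \<open>m\<close> of a leaf,
  \<open>f m (f (m + 1) (... (f (n - 1) x)))\<close>. The reversed indexing through
  \<open>bcomp\<close> makes \<open>anc 0\<close> the composition of the theorem when
  \<open>f m = Bs (n - m)\<close>.\<close>

definition anc :: "nat \<Rightarrow> complex \<Rightarrow> complex" where
  "anc m = bcomp (\<lambda>k. f (n - k)) (n - m)"

lemma anc_n [simp]: "anc n x = x"
  by (simp add: anc_def)

lemma anc_step: "m < n \<Longrightarrow> anc m x = f m (anc (Suc m) x)"
proof -
  assume m: "m < n"
  then have "n - m = Suc (n - Suc m)" by simp
  then show ?thesis using m by (simp add: anc_def)
qed

lemma anc_mem:
  assumes "m \<le> n" "x \<in> disc"
  shows "anc m x \<in> disc \<and> U m (anc m x) = U n x"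
  using assms(1)
proof (induction m rule: inc_induct)
  case base
  then show ?case using assms(2) by simp
next
  case (step m)
  then show ?case using fold_map_in_disc[OF fold] anc_step by simp
qed

lemma anc_zeros: "m \<le> n \<Longrightarrow> x \<in> zeros_in_disc (U n) \<Longrightarrow> anc m x \<in> zeros_in_disc (U m)"
  using anc_mem by (simp add: zeros_in_disc_def)

text \<open>An arbitrary choice of one child of \<open>y\<close>; the other one is its image under
  \<open>\<sigma> m\<close>. It serves only to label siblings by a bit.\<close>

definition fibre_rep :: "nat \<Rightarrow> complex \<Rightarrow> complex" where
  "fibre_rep m y = (SOME x. x \<in> disc \<and> f m x = y)"

lemma fibre_rep:
  assumes "m < n" "y \<in> disc"
  shows "fibre_rep m y \<in> disc" "f m (fibre_rep m y) = y"
proof -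
  have "\<exists>x. x \<in> disc \<and> f m x = y" using fold_map_surj[OF fold[OF assms(1)] assms(2)] by blast
  then have "fibre_rep m y \<in> disc \<and> f m (fibre_rep m y) = y" unfolding fibre_rep_def by (rule someI_ex)
  then show "fibre_rep m y \<in> disc" "f m (fibre_rep m y) = y" by auto
qed

text \<open>The bit of the deepest level goes last, so that prefixes of a leaf's address are the
  addresses of its ancestors, in accordance with \<open>take\<close> as the block map on
  words.\<close>

primrec address :: "nat \<Rightarrow> complex \<Rightarrow> bool list" where
  "address 0 x = []"
| "address (Suc m) x = address m (f m x) @ [x = fibre_rep m (f m x)]"

lemma length_address [simp]: "length (address m x) = m"
  by (induction m arbitrary: x) auto

lemma take_address:
  assumes "m \<le> n"
  shows "take m (address n x) = address m (anc m x)"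
  using assms
proof (induction m rule: inc_induct)
  case base
  then show ?case by simp
next
  case (step m)
  have "take m (address n x) = take m (take (Suc m) (address n x))" by simp
  also have "\<dots> = take m (address (Suc m) (anc (Suc m) x))" using step by simp
  also have "\<dots> = address m (anc m x)" using anc_step[OF step(2)] by simp
  finally show ?case .
qed

lemma address_inj:
  assumes "m \<le> n" "x \<in> zeros_in_disc (U m)" "y \<in> zeros_in_disc (U m)" "address m x = address m y"
  shows "x = y"
  using assms
proof (induction m arbitrary: x y)
  case 0
  then show ?case by (simp add: zeros_in_disc_def)
next
  case (Suc m)
  have m: "m < n" using Suc.prems by simp
  note F = fold[OF m]
  have xy: "x \<in> disc" "y \<in> disc" using Suc.prems by (auto simp: zeros_in_disc_def)
  have fxy: "f m x \<in> zeros_in_disc (U m)" "f m y \<in> zeros_in_disc (U m)"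
    using Suc.prems fold_map_in_disc[OF F] by (auto simp: zeros_in_disc_def)
  have eq: "f m x = f m y" using Suc.IH[OF _ fxy] Suc.prems by simp
  let ?r = "fibre_rep m (f m x)"
  have r: "?r \<in> disc" "f m ?r = f m x" using fibre_rep[OF m fold_map_in_disc[OF F xy(1)]] by auto
  have iff: "x = ?r \<longleftrightarrow> y = ?r" using Suc.prems(4) eq by auto
  have "x = ?r \<or> x = \<sigma> m ?r" "y = ?r \<or> y = \<sigma> m ?r"
    using fold_map_fibre[OF F r(1) xy(1)] fold_map_fibre[OF F r(1) xy(2)] r(2) eq by auto
  then show ?case using iff by auto
qed

end

context fold_tower
begin

lemma lifts_to_anc:
  assumes "m \<le> n" "lifts_to (U n) g x y"
  shows "lifts_to (U m) g (anc m x) (anc m y)"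
  using assms(1)
proof (induction m rule: inc_induct)
  case base
  then show ?case using assms(2) by simp
next
  case (step m)
  have "lifts_to (U m) g (f m (anc (Suc m) x)) (f m (anc (Suc m) y))"
    using step lifts_to_Suc by simp
  then show ?case using step anc_step by simp
qed

text \<open>This gives every node two different children, as \<open>\<sigma> m\<close> moves every
  point that is not over \<open>v m\<close>.\<close>

lemma zeros_not_critical_value:
  assumes "m < n" "w \<in> zeros_in_disc (U m)"
  shows "w \<noteq> v m"
proof
  assume "w = v m"
  then have "u m = 0" using assms by (simp add: u_def zeros_in_disc_def)
  then have "0 \<in> u ` {..<n}" using assms(1) by (metis image_eqI lessThan_iff)
  then show False using zero_value by simp
qed

lemma address_surj:
  assumes "m \<le> n" "length bs = m"
  shows "\<exists>x\<in>zeros_in_disc (U m). address m x = bs"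
  using assms
proof (induction m arbitrary: bs)
  case 0
  then show ?case by (auto simp: zeros_in_disc_def)
next
  case (Suc m)
  have m: "m < n" using Suc.prems by simp
  note F = fold[OF m]
  obtain cs b where bs: "bs = cs @ [b]" "length cs = m" using Suc.prems by (metis length_Suc_conv_rev)
  then obtain w where w: "w \<in> zeros_in_disc (U m)" "address m w = cs" using Suc.IH m by force
  have wd: "w \<in> disc" using w by (simp add: zeros_in_disc_def)
  let ?r = "fibre_rep m w"
  note r = fibre_rep[OF m wd]
  have s: "\<sigma> m ?r \<in> disc" "f m (\<sigma> m ?r) = w"
    using fold_map_flip_disc[OF F r(1)] fold_map_fibre[OF F r(1) fold_map_flip_disc[OF F r(1)]] r(2) by auto
  have neq: "\<sigma> m ?r \<noteq> ?r"
    using fold_map_flip_neq[OF F r(1)] r(2) zeros_not_critical_value[OF m w(1)] by simp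
  define x where "x = (if b then ?r else \<sigma> m ?r)"
  have "x \<in> disc" "f m x = w" "x = ?r \<longleftrightarrow> b" using r s neq by (auto simp: x_def)
  then show ?case using w bs by (intro bexI[of _ x]) (auto simp: zeros_in_disc_def)
qed

lemma address_bij: "bij_betw (address n) (zeros_in_disc (U n)) {bs. length bs = n}"
proof (rule bij_betw_imageI)
  show "inj_on (address n) (zeros_in_disc (U n))"
    using address_inj[OF order_refl] by (auto intro: inj_onI)
  show "address n ` zeros_in_disc (U n) = {bs. length bs = n}"
  proof (intro equalityI subsetI)
    fix bs :: "bool list" assume "bs \<in> {bs. length bs = n}"
    then obtain x where "x \<in> zeros_in_disc (U n)" "address n x = bs" using address_surj[of n bs] by auto
    then show "bs \<in> address n ` zeros_in_disc (U n)" by blast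
  qed auto
qed

text \<open>A swap preserves \<open>f m x\<close>, so swaps at different parents do not interfere
  and their loops can be concatenated.\<close>

lemma sibling_swaps_loop:
  assumes m: "m < n" and T: "finite T" "T \<subseteq> zeros_in_disc (U m)"
  shows "\<exists>g. path g \<and> pathstart g = 0 \<and> pathfinish g = 0 \<and> path_image g \<subseteq> base \<and>
    (\<forall>x\<in>zeros_in_disc (U (Suc m)). lifts_to (U (Suc m)) g x (if f m x \<in> T then \<sigma> m x else x))"
  using T
proof (induction T rule: finite_induct)
  case empty
  have "is_lift (U (Suc m)) (\<lambda>t. 0) (\<lambda>t. x)" if "x \<in> zeros_in_disc (U (Suc m))" for x
    using that unfolding is_lift_def by (auto simp: zeros_in_disc_def path_def path_image_def)
  then have "lifts_to (U (Suc m)) (\<lambda>t. 0) x x" if "x \<in> zeros_in_disc (U (Suc m))" for x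
    using that unfolding lifts_to_def pathstart_def pathfinish_def by blast
  moreover have "0 \<in> base" using zero_value by simp
  ultimately show ?case
    by (intro exI[of _ "\<lambda>t. 0"]) (auto simp: path_def pathstart_def pathfinish_def path_image_def)
next
  case (insert y T)
  note F = fold[OF m]
  obtain g where g: "path g" "pathstart g = 0" "pathfinish g = 0" "path_image g \<subseteq> base"
    and gT: "\<And>x. x \<in> zeros_in_disc (U (Suc m)) \<Longrightarrow> lifts_to (U (Suc m)) g x (if f m x \<in> T then \<sigma> m x else x)"
    using insert by blast
  have "y \<in> disc" "U m y = 0" using insert.prems by (auto simp: zeros_in_disc_def)
  then obtain g' where g': "path g'" "pathstart g' = 0" "pathfinish g' = 0" "path_image g' \<subseteq> base"
    and gy: "\<And>x. x \<in> disc \<Longrightarrow> U (Suc m) x = 0 \<Longrightarrow> lifts_to (U (Suc m)) g' x (if f m x = y then \<sigma> m x else x)"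
    using sibling_swap_loop[OF m] by blast
  have "lifts_to (U (Suc m)) (g +++ g') x (if f m x \<in> insert y T then \<sigma> m x else x)"
    if x: "x \<in> zeros_in_disc (U (Suc m))" for x
  proof -
    have xd: "x \<in> disc" "U (Suc m) x = 0" using x by (auto simp: zeros_in_disc_def)
    have s: "\<sigma> m x \<in> disc" "f m (\<sigma> m x) = f m x"
      using fold_map_flip_disc[OF F xd(1)] fold_map_fibre[OF F xd(1) fold_map_flip_disc[OF F xd(1)]] by auto
    define z where "z = (if f m x \<in> T then \<sigma> m x else x)"
    have z: "z \<in> disc" "U (Suc m) z = 0" "f m z = f m x" using xd s by (auto simp: z_def)
    have "lifts_to (U (Suc m)) (g +++ g') x (if f m z = y then \<sigma> m z else z)"
      using lifts_to_join[OF gT[OF x, folded z_def] gy[OF z(1,2)]] .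
    moreover have "(if f m z = y then \<sigma> m z else z) = (if f m x \<in> insert y T then \<sigma> m x else x)"
      using insert.hyps(2) z(3) by (auto simp: z_def)
    ultimately show ?thesis by simp
  qed
  then show ?case
    using g g' subset_path_image_join[OF g(4) g'(4)] by (intro exI[of _ "g +++ g'"]) (auto intro: path_join_imp)
qed

end

section \<open>Monodromy permutations and tree automorphisms\<close>

context blaschke_tower
begin

lemma mono_perm_eqI:
  assumes "g \<in> mono_loops B" "x \<in> Z" "lifts_to (U n) g x y"
  shows "mono_perm B g x = y"
  using lifts_to_unique[OF order_refl] mono_perm_lifts_to[OF assms(1,2)] assms by (auto simp: mono_loops_iff)

lemma mono_perm_mem:
  assumes "g \<in> mono_loops B" "x \<in> Z"
  shows "mono_perm B g x \<in> Z"
proof -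
  obtain h where h: "is_lift (U n) g h" "pathfinish h = mono_perm B g x"
    using mono_perm_lifts_to[OF assms] unfolding lifts_to_def by blast
  show ?thesis using is_lift_ends(2,4)[OF h(1)] h(2) assms(1) by (simp add: mono_loops_iff zeros_in_disc_def)
qed

lemma mono_perm_anc_lifts_to:
  assumes "g \<in> mono_loops B" "x \<in> Z" "m \<le> n"
  shows "lifts_to (U m) g (anc m x) (anc m (mono_perm B g x))"
  using lifts_to_anc[OF assms(3) mono_perm_lifts_to[OF assms(1,2)]] .

text \<open>At depth \<open>m\<close>, lifts with equal starts have equal ends; applying this to the
  reversed loop gives the converse.\<close>

lemma mono_perm_anc_iff:
  assumes g: "g \<in> mono_loops B" and x: "x \<in> Z" and y: "y \<in> Z" and m: "m \<le> n"
  shows "anc m (mono_perm B g x) = anc m (mono_perm B g y) \<longleftrightarrow> anc m x = anc m y"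
proof -
  have g': "path g" "path_image g \<subseteq> base" "path (reversepath g)" "path_image (reversepath g) \<subseteq> base"
    using g by (auto simp: mono_loops_iff path_image_reversepath)
  note L = mono_perm_anc_lifts_to[OF g x m] mono_perm_anc_lifts_to[OF g y m]
  show ?thesis
    using lifts_to_unique[OF m g'(1,2)] L lifts_to_unique[OF m g'(3,4)] L[THEN lifts_to_reverse] by metis
qed

lemma mono_perm_in_tree_auts:
  assumes "g \<in> mono_loops B"
  shows "mono_perm B g \<in> tree_auts n anc Z"
  using mono_perm_outside mono_perm_mem[OF assms] mono_perm_anc_iff[OF assms]
  by (intro tree_autsI) blast+

lemma mono_loops_join:
  assumes "g \<in> mono_loops B" "g' \<in> mono_loops B"
  shows "g +++ g' \<in> mono_loops B"
  using assms subset_path_image_join[of g base g'] unfolding mono_loops_iff by (auto intro: path_join_imp)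

lemma mono_perm_join:
  assumes g: "g \<in> mono_loops B" and g': "g' \<in> mono_loops B" and x: "x \<in> Z"
  shows "mono_perm B (g +++ g') x = mono_perm B g' (mono_perm B g x)"
  using lifts_to_join[OF mono_perm_lifts_to[OF g x] mono_perm_lifts_to[OF g' mono_perm_mem[OF g x]]]
  by (intro mono_perm_eqI mono_loops_join g g' x)

lemma finite_zeros: "m \<le> n \<Longrightarrow> finite (zeros_in_disc (U m))"
  using finite_preimage[of m "{0}"] by (simp add: zeros_in_disc_def)

text \<open>Going down the tree one level at a time, the siblings on which \<open>p\<close> and the permutation realized so
  far disagree are exchanged by composing with loops that each swap a single pair.\<close>

lemma tree_aut_realized:
  assumes p: "p \<in> tree_auts n anc Z" and "m \<le> n"
  shows "\<exists>g\<in>mono_loops B. \<forall>x\<in>Z. anc m (mono_perm B g x) = anc m (p x)"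
  using assms(2)
proof (induction m)
  case 0
  obtain g where "path g" "pathstart g = 0" "pathfinish g = 0" "path_image g \<subseteq> base"
  proof (rule that[of "\<lambda>t. 0"])
    show "path_image (\<lambda>t. 0) \<subseteq> base" using zero_value by (auto simp: path_image_def)
  qed (auto simp: path_def pathstart_def pathfinish_def)
  then have "g \<in> mono_loops B" by (simp add: mono_loops_iff)
  \<comment> \<open>At depth 0 all leaves share the root, so any loop will do, for instance the
    constant one.\<close>
  moreover have "anc 0 x = 0" if "x \<in> Z" for x
    using anc_zeros[OF _ that, of 0] by (simp add: zeros_in_disc_def)
  ultimately show ?case using mono_perm_mem tree_autsD(2)[OF p] by (intro bexI[of _ g]) auto
next
  case (Suc m)
  have m: "m < n" "m \<le> n" "Suc m \<le> n" using Suc.prems by auto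
  note F = fold[OF m(1)]
  obtain g where g: "g \<in> mono_loops B" and gm: "\<And>x. x \<in> Z \<Longrightarrow> anc m (mono_perm B g x) = anc m (p x)"
    using Suc.IH m by auto
  define a where "a x = anc (Suc m) (mono_perm B g x)" for x
  define b where "b x = anc (Suc m) (p x)" for x
  have pZ: "p x \<in> Z" and gZ: "mono_perm B g x \<in> Z" if "x \<in> Z" for x
    using tree_autsD(2)[OF p that] mono_perm_mem[OF g that] by auto
  have aZ: "a x \<in> zeros_in_disc (U (Suc m))" and bZ: "b x \<in> zeros_in_disc (U (Suc m))" if "x \<in> Z" for x
    using anc_zeros[OF m(3)] pZ gZ that by (auto simp: a_def b_def)
  have fa: "f m (a x) = anc m (p x)" and fb: "f m (b x) = anc m (p x)" if "x \<in> Z" for x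
    using anc_step[OF m(1)] gm[OF that] by (auto simp: a_def b_def)
  have ab: "a x = a y \<longleftrightarrow> b x = b y" if "x \<in> Z" "y \<in> Z" for x y
    using mono_perm_anc_iff[OF g that m(3)] tree_autsD(3)[OF p m(3) that] by (simp add: a_def b_def)
  \<comment> \<open>The depth-\<open>m\<close> nodes below which the permutation realized so far
    sends some leaf to the wrong child.\<close>
  define T where "T = (\<lambda>x. anc m (p x)) ` {x \<in> Z. a x \<noteq> b x}"
  have "T \<subseteq> zeros_in_disc (U m)" using anc_zeros[OF m(2)] pZ by (auto simp: T_def)
  then obtain g' where g': "g' \<in> mono_loops B"
    and swap: "\<And>x. x \<in> zeros_in_disc (U (Suc m)) \<Longrightarrow> lifts_to (U (Suc m)) g' x (if f m x \<in> T then \<sigma> m x else x)"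
    using sibling_swaps_loop[OF m(1) finite_subset[OF _ finite_zeros[OF m(2)]]] unfolding mono_loops_iff by metis
  have "anc (Suc m) (mono_perm B (g +++ g') x) = b x" if x: "x \<in> Z" for x
  proof -
    have "lifts_to (U (Suc m)) g' (a x) (anc (Suc m) (mono_perm B (g +++ g') x))"
      using mono_perm_anc_lifts_to[OF g' gZ[OF x] m(3)] mono_perm_join[OF g g' x] by (simp add: a_def)
    then have "anc (Suc m) (mono_perm B (g +++ g') x) = (if f m (a x) \<in> T then \<sigma> m (a x) else a x)"
      using lifts_to_unique[OF m(3)] swap[OF aZ[OF x]] g' unfolding mono_loops_iff by metis
    also have "\<dots> = b x"
    \<comment> \<open>Membership in \<open>T\<close> may be witnessed by a leaf \<open>y\<close>
      other than \<open>x\<close>. By \<open>ab\<close>, the maps \<open>a\<close> and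
      \<open>b\<close> identify the same leaves, and over this node both take values in one
      two-point fibre; so a disagreement at \<open>y\<close> forces one at \<open>x\<close>.\<close>
    proof (cases "f m (a x) \<in> T")
      case True
      have fib: "z = a x \<or> z = \<sigma> m (a x)" if "z \<in> disc" "f m z = f m (a x)" for z
        using fold_map_fibre[OF F _ that(1), of "a x"] aZ[OF x] that(2) by (simp add: zeros_in_disc_def)
      obtain y where y: "y \<in> Z" "a y \<noteq> b y" "anc m (p y) = anc m (p x)"
        using True fa[OF x] by (auto simp: T_def)
      have "a y = a x \<or> a y = \<sigma> m (a x)" "b y = a x \<or> b y = \<sigma> m (a x)" "b x = a x \<or> b x = \<sigma> m (a x)"
        using fib[of "a y"] fib[of "b y"] fib[of "b x"] aZ[OF y(1)] bZ[OF y(1)] bZ[OF x]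
          fa[OF y(1)] fb[OF y(1)] fb[OF x] fa[OF x] y(3)
        by (simp_all add: zeros_in_disc_def)
      then have "b x = \<sigma> m (a x)" using ab[OF x y(1)] y(2) by metis
      then show ?thesis using True by simp
    next
      case False
      then have "a x = b x" using fa[OF x] x unfolding T_def by blast
      then show ?thesis using False by simp
    qed
    finally show ?thesis .
  qed
  then show ?case using mono_loops_join[OF g g'] by (auto simp: b_def)
qed

lemma monodromy_carrier: "mono_perm B ` mono_loops B = tree_auts n anc Z"
proof (intro equalityI subsetI)
  fix p assume p: "p \<in> tree_auts n anc Z"
  then obtain g where g: "g \<in> mono_loops B" "\<And>x. x \<in> Z \<Longrightarrow> mono_perm B g x = p x"
    using tree_aut_realized[OF p order_refl] by auto
  have "mono_perm B g x = p x" for x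
    using g(2) mono_perm_outside tree_autsD(1)[OF p] by (cases "x \<in> Z") auto
  then have "p = mono_perm B g" by (intro ext) simp
  then show "p \<in> mono_perm B ` mono_loops B" using g(1) by (rule image_eqI)
qed (use mono_perm_in_tree_auts in auto)

lemma monodromy_group_iso: "monodromy_group B \<cong> wreath_Z2 n"
  unfolding monodromy_group_def wreath_Z2_def monodromy_carrier wreath_Z2_carrier_eq
proof (rule tree_auts_iso[OF address_bij])
  fix m x y assume m: "m \<le> n" and x: "x \<in> Z" and y: "y \<in> Z"
  show "take m (address n x) = take m (address n y) \<longleftrightarrow> anc m x = anc m y"
    using address_inj[OF m anc_zeros[OF m x] anc_zeros[OF m y]] take_address[OF m] by auto
qed

end

lemma bcomp_cong:
  assumes "\<And>k. k \<in> {1..m} \<Longrightarrow> F k = G k"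
  shows "bcomp F m = bcomp G m"
  using assms by (induction m) auto

theorem theorem5p7:
  fixes B :: "complex \<Rightarrow> complex" and Bs :: "nat \<Rightarrow> complex \<Rightarrow> complex" and d n :: nat
  assumes "regularized d B"
    and "\<forall>z\<in>crit_points B. deriv (deriv B) z \<noteq> 0"
    and "card (B ` crit_points B) = n"
    and "\<forall>j\<in>{1..n}. regularized 2 (Bs j) \<and> Bs j 0 = 0"
    and "\<forall>z\<in>ball 0 1. B z = bcomp Bs n z"
  shows "monodromy_group B \<cong> wreath_Z2 n"
proof -
  \<comment> \<open>The order is reversed so that \<open>f 0 = Bs n\<close> is the outermost factor,
    next to the root.\<close>
  define f where "f m = Bs (n - m)" for m
  have "\<exists>c \<sigma> v. fold_map (f m) c \<sigma> v" if "m < n" for m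
  proof -
    have "regularized 2 (f m)" using assms(4) that by (simp add: f_def)
    then show ?thesis using regularized_2_fold_map by metis
  qed
  then obtain c \<sigma> v where "\<And>m. m < n \<Longrightarrow> fold_map (f m) (c m) (\<sigma> m) (v m)" by metis
  then interpret fold_chain f \<sigma> c v n by unfold_locales
  have B: "B z = U n z" if z: "z \<in> disc" for z
  proof -
    have "bcomp (\<lambda>k. f (n - k)) n = bcomp Bs n" by (rule bcomp_cong) (auto simp: f_def)
    then have "B z = anc 0 z" using assms(5) z by (simp add: anc_def)
    then show ?thesis using anc_mem[OF _ z, of 0] by simp
  qed
  have cv: "B ` crit_points B = u ` {..<n}" by (rule crit_values_eq) (rule B)
  \<comment> \<open>The critical values are the \<open>n\<close> numbers \<open>u m\<close>; having
    exactly \<open>n\<close> distinct ones forces \<open>u\<close> to be injective.\<close>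
  have "card (u ` {..<n}) = card {..<n}" using assms(3) cv by simp
  then have inj: "inj_on u {..<n}" by (intro eq_card_imp_inj_on) auto
  obtain \<gamma> a where a: "blaschke_factors d \<gamma> a B" "inj_on a {..<d}"
    using assms(1) unfolding regularized_def by blast
  have "0 \<notin> B ` crit_points B"
    using blaschke_simple_zero_deriv[OF a] by (auto simp: crit_points_def)
  then interpret blaschke_tower f \<sigma> c v n B
    using inj cv B by unfold_locales auto
  show ?thesis by (rule monodromy_group_iso)
qed

end
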